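(* Let $\mathcal P_{\alpha_1,\ldots,\alpha_k}$ be a linear partition family. Then there exist $\delta>0$ and $N\in\mathbb N$ so that for every $n\ge N$ (with $(n,k,P_n)\in\mathcal P_{\alpha_1,\ldots,\alpha_k}$), the probability that the randomized rounding algorithm described below fails to solve $(n,k,P_n)$ is at most $e^{-\delta n}$.
   Context: Setting. For positive integers $n,k$ let $s^{n,k}=\frac{n(n+1)}{2k}$ (the common target sum). Let $[\alpha_1,\ldots,\alpha_k]$ be a non-descending sequence of positive rational numbers with $\sum_{i=1}^k\alpha_i=1$. Put $A_j=\sum_{j'=1}^j\alpha_{j'}$, $\mathrm{slack}_j(A)=A_j(1-\frac{A_j}{2})-\frac{j}{2k}$ and $\mathrm{slack}(A)=\min_{1\le j<k}\mathrm{slack}_j(A)$, and assume $\mathrm{slack}(A)>0$. The linear partition family $\mathcal P_{\alpha_1,\ldots,\alpha_k}$ is the set of equal sum partition problems $(n,k,P_n=[\alpha_1 n,\ldots,\alpha_k n])$, where $n$ is a positive integer such that all $\alpha_j n$ are integers and $s^{n,k}$ is an integer; solving such an instance means partitioning $\{1,\ldots,n\}$ into sets $Q_1,\ldots,Q_k$ with $|Q_j|=\alpha_j n$ and element sum $S(Q_j)=s^{n,k}$ for all $j$. The algorithm (randomized rounding). (1) Form the fractional (fluid mixing) problem with $n$ sources and $k$ targets: $a_i=n-i+1$, $u_i=1$ for $i\in[n]$, $b_j=s^{n,k}$, $v_j=\alpha_j n$ for $j\in[k]$, and compute a fractional solution $x_{i,j}\ge 0$ with $\sum_j x_{i,j}=1$,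 $\sum_i u_i x_{i,j}=v_j$, $\sum_i a_i x_{i,j}=b_j$, using the following recursive procedure (sources and targets ordered by non-increasing density $a_i/u_i$, $b_j/v_j$): if $k=1$, send everything to the single target; else if $u_1=0$, drop the first source (its row is $[1,0,\ldots,0]$) and recurse; else if $v_1=0$, drop the first target (zero column) and recurse; else if $b_1/v_1=b_2/v_2$, merge the first two targets, recurse, and split the merged column in proportions $\gamma=v_1/(v_1+v_2)$ and $1-\gamma$; otherwise pour a fraction $\lambda=\min\big(1,\frac{v_1}{u_1},\frac{b_1v_2-v_1b_2}{a_1v_2-u_1b_2}\big)$ of the first source into the first target (subtract $\lambda a_1,\lambda u_1$ from $a_1,u_1,b_1,v_1$ accordingly), recurse, and set row 1 to $\lambda\delta_1+(1-\lambda)\cdot$(row 1 of the recursive solution). (2) Independently for each $i\in[n]$ choose $X_i\in[k]$ with $\Pr[X_i=j]=x_{i,j}$, and set $Q_j=\{n-i+1: X_i=j\}$. (3) While some $|Q_{j'}|>\alpha_{j'}n$ and some $|Q_{j''}|<\alpha_{j''}n$, move an element of $Q_{j'}$ to $Q_{j''}$. (4) While some $S(Q_j)\ne s^{n,k}$: let $j'$ maximize and $j''$ minimize $S(Q_j)$, let $\Delta=\min(S(Q_{j'})-s^{n,k},\,s^{n,k}-S(Q_{j''}))$; if there are $z'\in Q_{j'}$, $z''\in Q_{j''}$ with $0<z'-z''\le\Delta$, choose such a pair with $z'-z''$ maximal and swap them; otherwise return Failure. Finally return $Q_1,\ldots,Q_k$. *)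

theory Defs
  imports "HOL-Probability.Probability"
begin

definition target_sum :: "nat \<Rightarrow> nat \<Rightarrow> real" where
  "target_sum n k = real n * (real n + 1) / (2 * real k)"

text \<open>The sequence $[\alpha_1,\dots,\alpha_k]$ is a list, so that $\alpha_j$ is \<open>\<alpha> ! (j - 1)\<close> and
  $k$ is \<open>length \<alpha>\<close>.\<close>

definition slack_at :: "real list \<Rightarrow> nat \<Rightarrow> real" where
  "slack_at \<alpha> j =
     (let A = sum_list (take j \<alpha>) in A * (1 - A / 2) - real j / (2 * real (length \<alpha>)))"

text \<open>The minimum is taken in the extended reals, so that it is $\infty$ when $k = 1$ and the range
  $1 \le j < k$ is empty.\<close>

definition slack :: "real list \<Rightarrow> ereal" where
  "slack \<alpha> = (INF j\<in>{1..<length \<alpha>}. ereal (slack_at \<alpha> j))"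

definition linear_partition_family :: "real list \<Rightarrow> (nat \<times> nat \<times> nat list) set" where
  "linear_partition_family \<alpha> =
     {(n, k, P). n > 0 \<and> k = length \<alpha> \<and> map real P = map (\<lambda>a. a * real n) \<alpha> \<and>
                 target_sum n k \<in> \<int>}"

text \<open>A candidate solution is a function \<open>Q\<close> of which only the values at $1,\dots,k$ matter.\<close>

definition solves :: "nat \<Rightarrow> nat \<Rightarrow> nat list \<Rightarrow> (nat \<Rightarrow> nat set) \<Rightarrow> bool" where
  "solves n k P Q \<longleftrightarrow>
     (\<Union>j\<in>{1..k}. Q j) = {1..n} \<and> disjoint_family_on Q {1..k} \<and>
     (\<forall>j\<in>{1..k}. card (Q j) = P ! (j - 1) \<and> real (\<Sum>(Q j)) = target_sum n k)"

text \<open>Sources are pairs $(a_i,u_i)$ and targets are pairs $(b_j,v_j)$. A fractional solution is the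
  list of its rows.\<close>

definition fractional_solution ::
  "(real \<times> real) list \<Rightarrow> (real \<times> real) list \<Rightarrow> real list list \<Rightarrow> bool" where
  "fractional_solution ss ts x \<longleftrightarrow>
     length x = length ss \<and> (\<forall>i<length ss. length (x ! i) = length ts) \<and>
     (\<forall>i<length ss. \<forall>j<length ts. 0 \<le> x ! i ! j) \<and>
     (\<forall>i<length ss. (\<Sum>j<length ts. x ! i ! j) = 1) \<and>
     (\<forall>j<length ts. (\<Sum>i<length ss. snd (ss ! i) * x ! i ! j) = snd (ts ! j)) \<and>
     (\<forall>j<length ts. (\<Sum>i<length ss. fst (ss ! i) * x ! i ! j) = fst (ts ! j))"

fun split_first :: "real \<Rightarrow> real list \<Rightarrow> real list" where
  "split_first \<gamma> [] = []"
| "split_first \<gamma> (y # r) = \<gamma> * y # (1 - \<gamma>) * y # r"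

text \<open>\<open>pour_row l r\<close> is $l\,\delta_1 + (1-l)\,r$, where $\delta_1$ is the first unit vector.\<close>

fun pour_row :: "real \<Rightarrow> real list \<Rightarrow> real list" where
  "pour_row l [] = []"
| "pour_row l (y # r) = (l + (1 - l) * y) # map (\<lambda>z. (1 - l) * z) r"

text \<open>Source and target lists are expected in order of non-increasing density. No step of the
  recursion needs to sort again: pouring does not change the density of the first source, lowers the
  density of the first target to no less than that of the second, and merging joins targets of equal
  density. On inputs without a fractional solution the recursion may diverge, which gives
  \<open>None\<close>; so does running out of sources with several targets left.\<close>

partial_function (option) fluid_mixing ::
  "(real \<times> real) list \<Rightarrow> (real \<times> real) list \<Rightarrow> real list list option" where
  "fluid_mixing ss ts =
    (case ts of
       [] \<Rightarrow> None
     | (b1, v1) # ts' \<Rightarrow>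
       (case ts' of
          [] \<Rightarrow> Some (map (\<lambda>_. [1]) ss)
        | (b2, v2) # ts'' \<Rightarrow>
          (case ss of
             [] \<Rightarrow> None
           | (a1, u1) # ss' \<Rightarrow>
             if u1 = 0 then
               Option.bind (fluid_mixing ss' ts)
                 (\<lambda>x. Some ((1 # replicate (length ts - 1) 0) # x))
             else if v1 = 0 then
               Option.bind (fluid_mixing ss ts') (\<lambda>x. Some (map (\<lambda>r. 0 # r) x))
             else if b1 / v1 = b2 / v2 then
               Option.bind (fluid_mixing ss ((b1 + b2, v1 + v2) # ts''))
                 (\<lambda>x. Some (map (split_first (v1 / (v1 + v2))) x))
             else
               (let l = min 1 (min (v1 / u1) ((b1 * v2 - v1 * b2) / (a1 * v2 - u1 * b2)))
                in Option.bind
                     (fluid_mixing ((a1 - l * a1, u1 - l * u1) # ss')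
                                   ((b1 - l * a1, v1 - l * u1) # ts'))
                     (\<lambda>x. Some (pour_row l (hd x) # tl x))))))"

definition instance_sources :: "nat \<Rightarrow> (real \<times> real) list" where
  "instance_sources n = map (\<lambda>i. (real (n - i + 1), 1)) [1..<n + 1]"

definition instance_targets :: "nat \<Rightarrow> nat \<Rightarrow> nat list \<Rightarrow> (real \<times> real) list" where
  "instance_targets n k P = map (\<lambda>j. (target_sum n k, real (P ! (j - 1)))) [1..<k + 1]"

text \<open>The values $X_1,\dots,X_n \in \{1,\dots,k\}$ are independent with
  $\Pr[X_i = j] = x_{i,j}$; outside of $\{1,\dots,n\}$ the function is $0$.\<close>

definition rounding_pmf :: "nat \<Rightarrow> nat \<Rightarrow> real list list \<Rightarrow> (nat \<Rightarrow> nat) pmf" where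
  "rounding_pmf n k x =
     Pi_pmf {1..n} 0
       (\<lambda>i. embed_pmf (\<lambda>j. if j \<in> {1..k} then x ! (i - 1) ! (j - 1) else 0))"

definition rounded_sets :: "nat \<Rightarrow> (nat \<Rightarrow> nat) \<Rightarrow> nat \<Rightarrow> nat set" where
  "rounded_sets n X j = {n - i + 1 | i. i \<in> {1..n} \<and> X i = j}"

definition extremal_sums :: "nat \<Rightarrow> (nat \<Rightarrow> nat set) \<Rightarrow> nat \<Rightarrow> nat \<Rightarrow> bool" where
  "extremal_sums k Q j' j'' \<longleftrightarrow>
     j' \<in> {1..k} \<and> j'' \<in> {1..k} \<and>
     (\<forall>j\<in>{1..k}. \<Sum>(Q j) \<le> \<Sum>(Q j')) \<and> (\<forall>j\<in>{1..k}. \<Sum>(Q j'') \<le> \<Sum>(Q j))"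

definition swap_pairs ::
  "nat \<Rightarrow> nat \<Rightarrow> (nat \<Rightarrow> nat set) \<Rightarrow> nat \<Rightarrow> nat \<Rightarrow> (nat \<times> nat) set" where
  "swap_pairs n k Q j' j'' =
     (let \<Delta> = min (real (\<Sum>(Q j')) - target_sum n k) (target_sum n k - real (\<Sum>(Q j'')))
      in {(z', z''). z' \<in> Q j' \<and> z'' \<in> Q j'' \<and> 0 < real z' - real z'' \<and> real z' - real z'' \<le> \<Delta>})"

text \<open>The two loops after the rounding leave choices open: which element to move where, which of
  several maximal or minimal sums to use, and which of several pairs of maximal difference to swap.
  They are modelled by a transition relation that allows every choice.\<close>

datatype config =
  Moving "nat \<Rightarrow> nat set" | Swapping "nat \<Rightarrow> nat set" | Returned "nat \<Rightarrow> nat set" | Failure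

inductive rr_step :: "nat \<Rightarrow> nat \<Rightarrow> nat list \<Rightarrow> config \<Rightarrow> config \<Rightarrow> bool" for n k P where
  move:
    "\<lbrakk>j' \<in> {1..k}; j'' \<in> {1..k}; card (Q j') > P ! (j' - 1); card (Q j'') < P ! (j'' - 1); z \<in> Q j'\<rbrakk>
     \<Longrightarrow> rr_step n k P (Moving Q) (Moving (Q(j' := Q j' - {z}, j'' := insert z (Q j''))))"
| moving_done:
    "\<not> ((\<exists>j'\<in>{1..k}. card (Q j') > P ! (j' - 1)) \<and> (\<exists>j''\<in>{1..k}. card (Q j'') < P ! (j'' - 1)))
     \<Longrightarrow> rr_step n k P (Moving Q) (Swapping Q)"
| swap:
    "\<lbrakk>\<exists>j\<in>{1..k}. real (\<Sum>(Q j)) \<noteq> target_sum n k; extremal_sums k Q j' j'';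
      (z', z'') \<in> swap_pairs n k Q j' j'';
      \<forall>(y', y'')\<in>swap_pairs n k Q j' j''. real y' - real y'' \<le> real z' - real z''\<rbrakk>
     \<Longrightarrow> rr_step n k P (Swapping Q)
           (Swapping (Q(j' := insert z'' (Q j' - {z'}), j'' := insert z' (Q j'' - {z''}))))"
| fail:
    "\<lbrakk>\<exists>j\<in>{1..k}. real (\<Sum>(Q j)) \<noteq> target_sum n k; extremal_sums k Q j' j'';
      swap_pairs n k Q j' j'' = {}\<rbrakk>
     \<Longrightarrow> rr_step n k P (Swapping Q) Failure"
| swapping_done:
    "\<forall>j\<in>{1..k}. real (\<Sum>(Q j)) = target_sum n k
     \<Longrightarrow> rr_step n k P (Swapping Q) (Returned Q)"

text \<open>An execution fails to solve the instance if it ends in anything but a returned solution, or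
  does not end at all. A start configuration is bad as soon as one choice of steps leads to such an
  execution, so that the probability below bounds the failure probability under every rule for
  making the choices.\<close>

definition can_fail :: "nat \<Rightarrow> nat \<Rightarrow> nat list \<Rightarrow> config \<Rightarrow> bool" where
  "can_fail n k P c \<longleftrightarrow>
     (\<exists>c'. (rr_step n k P)\<^sup>*\<^sup>* c c' \<and> (\<nexists>c''. rr_step n k P c' c'') \<and>
           \<not> (\<exists>Q. c' = Returned Q \<and> solves n k P Q)) \<or>
     (\<exists>f. f 0 = c \<and> (\<forall>i. rr_step n k P (f i) (f (Suc i))))"

text \<open>If the recursive procedure does not deliver a fractional solution, the algorithm fails with
  certainty.\<close>

definition rr_failure_prob :: "nat \<times> nat \<times> nat list \<Rightarrow> real" where
  "rr_failure_prob = (\<lambda>(n, k, P).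
     case fluid_mixing (instance_sources n) (instance_targets n k P) of
       None \<Rightarrow> 1
     | Some x \<Rightarrow>
         if fractional_solution (instance_sources n) (instance_targets n k P) x
         then measure_pmf.prob (rounding_pmf n k x)
                {X. can_fail n k P (Moving (rounded_sets n X))}
         else 1)"

end

theory Submission
  imports Defs
begin

text \<open>Positive slack keeps the merged target from running empty before the next target is merged, and
  it leaves a linear volume in it at each merge. Hence all targets get merged while the \<open>\<alpha>\<^sub>k n\<close>
  smallest elements are still unpoured, every split proportion is bounded below, and each small
  element goes to each set with probability at least a constant \<open>\<eta>\<close>. By Hoeffding's inequality, up to
  an exponentially small probability, all sizes and sums are within \<open>\<epsilon> n\<close> and \<open>\<epsilon> n\<^sup>2\<close> of their
  targets, and every ordered pair of sets admits linearly many swaps of difference \<open>1\<close> and of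
  difference \<open>D = \<lfloor>\<kappa> n\<rfloor>\<close>, taken from disjoint pairs of elements. The moves and the \<open>O((\<epsilon>/\<kappa> + k \<kappa>) n)\<close>
  swaps spoil fewer pairs than that, so for \<open>\<epsilon> \<lless> \<kappa> \<lless> 1\<close> a swap is available until all sums are equal.\<close>

section \<open>Fluid mixing\<close>

text \<open>Only the initial rounding is random; all later choices are adversarial. Past the
  rounding the argument is therefore a deterministic invariant on integers, and probability enters
  only to show that the rounded sets satisfy it. Two swap differences are needed because the sums
  are controlled only up to order n^2, while only linearly many pairs are available, so unit swaps
  alone would exhaust them. Swaps of difference at least D remove the bulk. Once the total deviation
  is at most 2kD, a D-swap may exceed the bound \<Delta>; unit swaps then finish, and they stay
  admissible because the target sum is an integer, so a nonzero deviation is at least 1 in absolute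
  value. The algorithm may swap a pair outside the counted ones. Maximality of its choice still
  gives a difference of at least D whenever a counted D-pair is admissible, and since the counted
  pairs are disjoint, each touched element destroys at most one of them for each difference. The
  recursion is a partial function, so success on the instance has to be proved together with the
  lower bound on its entries.\<close>

lemma split_first_nth:
  assumes "r \<noteq> []"
  shows "split_first g r ! 0 = g * r ! 0"
    and "split_first g r ! Suc 0 = (1 - g) * r ! 0"
    and "split_first g r ! Suc (Suc j) = r ! Suc j"
    and "length (split_first g r) = Suc (length r)"
  using assms by (cases r; simp)+

lemma pour_row_nth:
  assumes "r \<noteq> []"
  shows "pour_row l r ! 0 = l + (1 - l) * r ! 0"
    and "j < length r - 1 \<Longrightarrow> pour_row l r ! Suc j = (1 - l) * r ! Suc j"
    and "length (pour_row l r) = length r"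
  using assms by (cases r; simp)+

lemma fractional_solution_single:
  assumes "(\<Sum>i<length ss. snd (ss ! i)) = v" "(\<Sum>i<length ss. fst (ss ! i)) = b"
  shows "fractional_solution ss [(b, v)] (map (\<lambda>_. [1]) ss)"
  using assms by (simp add: fractional_solution_def)

lemma fractional_solution_drop_source:
  assumes "fractional_solution ss ts x" "ts \<noteq> []"
  shows "fractional_solution ((0, 0) # ss) ts ((1 # replicate (length ts - 1) 0) # x)"
proof -
  obtain t ts' where ts: "ts = t # ts'"
    using assms(2) by (cases ts) auto
  have "(\<Sum>j<length ts. (1 # replicate (length ts - 1) (0::real)) ! j) = 1"
    by (simp add: ts sum.lessThan_Suc_shift del: sum.lessThan_Suc)
  moreover have "0 \<le> (1 # replicate (length ts - 1) (0::real)) ! j" if "j < length ts" for j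
    using that by (cases j) (auto simp: ts)
  ultimately show ?thesis
    using assms(1) unfolding fractional_solution_def
    by (simp add: All_less_Suc2 sum.lessThan_Suc_shift ts del: sum.lessThan_Suc)
qed

text \<open>Equal density enters as one common share \<open>g\<close> of both quantities, so scaling
  the merged column by \<open>g\<close> and \<open>1 - g\<close> meets both column equations of both
  targets at once.\<close>

lemma fractional_solution_merge:
  assumes x: "fractional_solution ss ((b1 + b2, v1 + v2) # ts) x"
    and g: "0 \<le> g" "g \<le> 1" and b: "b1 = g * (b1 + b2)" and v: "v1 = g * (v1 + v2)"
  shows "fractional_solution ss ((b1, v1) # (b2, v2) # ts) (map (split_first g) x)"
proof -
  have len: "length x = length ss" "\<And>i. i < length ss \<Longrightarrow> length (x ! i) = Suc (length ts)"
    using x by (auto simp: fractional_solution_def)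
  then have ne: "x ! i \<noteq> []" if "i < length ss" for i
    using that by fastforce
  have nonneg: "0 \<le> x ! i ! 0" "\<And>j. j < length ts \<Longrightarrow> 0 \<le> x ! i ! Suc j" if "i < length ss" for i
    using x that by (auto simp: fractional_solution_def)
  have row: "x ! i ! 0 + (\<Sum>j<length ts. x ! i ! Suc j) = 1" if "i < length ss" for i
    using x that by (simp add: fractional_solution_def sum.lessThan_Suc_shift del: sum.lessThan_Suc)
  have colv: "(\<Sum>i<length ss. snd (ss ! i) * x ! i ! 0) = v1 + v2"
    and colb: "(\<Sum>i<length ss. fst (ss ! i) * x ! i ! 0) = b1 + b2"
    and cols: "\<And>j. j < length ts \<Longrightarrow> (\<Sum>i<length ss. snd (ss ! i) * x ! i ! Suc j) = snd (ts ! j)"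
      "\<And>j. j < length ts \<Longrightarrow> (\<Sum>i<length ss. fst (ss ! i) * x ! i ! Suc j) = fst (ts ! j)"
    using x by (auto simp: fractional_solution_def All_less_Suc2)
  have sc: "(\<Sum>i<length ss. h (ss ! i) * (g * x ! i ! 0)) = g * (\<Sum>i<length ss. h (ss ! i) * x ! i ! 0)"
    "(\<Sum>i<length ss. h (ss ! i) * ((1 - g) * x ! i ! 0)) = (1 - g) * (\<Sum>i<length ss. h (ss ! i) * x ! i ! 0)"
    for h :: "real \<times> real \<Rightarrow> real"
    unfolding sum_distrib_left by (intro sum.cong refl; simp)+
  have "(1 - g) * (v1 + v2) = v2" "(1 - g) * (b1 + b2) = b2"
    using v b by (simp_all add: algebra_simps)
  moreover have "g * (x ! i ! 0) + ((1 - g) * (x ! i ! 0) + (\<Sum>j<length ts. x ! i ! Suc j)) = 1"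
    if "i < length ss" for i
    using row[OF that] by (simp add: algebra_simps)
  ultimately show ?thesis
    using g nonneg cols v b unfolding fractional_solution_def
    by (simp add: All_less_Suc2 sum.lessThan_Suc_shift sc len split_first_nth[OF ne] colv colb
        del: sum.lessThan_Suc)
qed

text \<open>For a source of weight w the identity w * (l + (1 - l) * y) = l * w + (w - l * w) * y
  separates what is poured now from what the smaller problem distributes.\<close>

lemma fractional_solution_pour:
  assumes x: "fractional_solution ((a - l * a, u - l * u) # ss) ((b - l * a, v - l * u) # ts) x"
    and l: "0 \<le> l" "l \<le> 1"
  shows "fractional_solution ((a, u) # ss) ((b, v) # ts) (pour_row l (hd x) # tl x)"
proof -
  obtain r x' where x_eq: "x = r # x'"
    using x by (cases x) (auto simp: fractional_solution_def)
  have r: "length r = Suc (length ts)" 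
    using x by (auto simp: fractional_solution_def x_eq All_less_Suc2)
  then have ne: "r \<noteq> []" by auto
  have row: "r ! 0 + (\<Sum>j<length ts. r ! Suc j) = 1"
    using x by (simp add: fractional_solution_def x_eq All_less_Suc2 sum.lessThan_Suc_shift del: sum.lessThan_Suc)
  have row': "l + (1 - l) * r ! 0 + (\<Sum>j<length ts. (1 - l) * r ! Suc j) = 1"
    unfolding sum_distrib_left[symmetric]
    using arg_cong[OF row, of "\<lambda>z. (1 - l) * z"] by (simp add: algebra_simps)
  have nonneg: "0 \<le> l + (1 - l) * r ! 0" "\<And>j. j < length ts \<Longrightarrow> 0 \<le> (1 - l) * r ! Suc j"
    using x l by (auto simp: fractional_solution_def x_eq All_less_Suc2)
  have cols: "w * (l + (1 - l) * y) + z = t" if "(w - l * w) * y + z = t - l * w" for w y z t :: real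
    using that by (simp add: algebra_simps)
  have cols': "w * ((1 - l) * y) + z = t" if "(w - l * w) * y + z = t" for w y z t :: real
    using that by (simp add: algebra_simps)
  have col0: "(u - l * u) * r ! 0 + (\<Sum>i<length ss. snd (ss ! i) * x' ! i ! 0) = v - l * u"
      "(a - l * a) * r ! 0 + (\<Sum>i<length ss. fst (ss ! i) * x' ! i ! 0) = b - l * a"
    and col: "\<And>j. j < length ts \<Longrightarrow> (u - l * u) * r ! Suc j + (\<Sum>i<length ss. snd (ss ! i) * x' ! i ! Suc j) = snd (ts ! j)"
      "\<And>j. j < length ts \<Longrightarrow> (a - l * a) * r ! Suc j + (\<Sum>i<length ss. fst (ss ! i) * x' ! i ! Suc j) = fst (ts ! j)"
    and rest: "length x' = length ss" "\<forall>i<length ss. length (x' ! i) = Suc (length ts)"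
      "\<forall>i<length ss. 0 \<le> x' ! i ! 0 \<and> (\<forall>j<length ts. 0 \<le> x' ! i ! Suc j)"
      "\<forall>i<length ss. x' ! i ! 0 + (\<Sum>j<length ts. x' ! i ! Suc j) = 1"
    using x by (simp_all add: fractional_solution_def x_eq All_less_Suc2 sum.lessThan_Suc_shift del: sum.lessThan_Suc)
  show ?thesis
    using cols[OF col0(1)] cols[OF col0(2)] cols'[OF col(1)] cols'[OF col(2)] rest nonneg row'
    unfolding fractional_solution_def
    by (simp add: x_eq All_less_Suc2 sum.lessThan_Suc_shift pour_row_nth[OF ne] r
        del: sum.lessThan_Suc)
qed

section \<open>The recursion on a partition instance\<close>

lemma sum_nth_sum_list: "(\<Sum>i<length xs. f (xs ! i)) = sum_list (map f xs)"
  by (simp add: sum_list_sum_nth atLeast0LessThan)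

locale mixing =
  fixes n k :: nat and v :: "nat \<Rightarrow> nat" and s c :: real
  assumes k_pos: "1 \<le> k"
    and v_mono: "\<And>j j'. j \<le> j' \<Longrightarrow> j' < k \<Longrightarrow> v j \<le> v j'"
    and v_ge: "\<And>j. j < k \<Longrightarrow> c * n \<le> v j"
    and v_sum: "(\<Sum>j<k. v j) = n"
    and s_eq: "k * s = n * (n + 1) / 2"
    and n_pos: "0 < n"
    and c_pos: "0 < c"
    and prefix_slack: "\<And>m. 1 \<le> m \<Longrightarrow> m < k \<Longrightarrow> m * s + c * n ^ 2 \<le> (\<Sum>l<(\<Sum>j<m. v j). real (n - l))"
begin

definition V :: "nat \<Rightarrow> nat" where
  "V m = (\<Sum>j<m. v j)"

text \<open>Sources are counted from 0 here, so source \<open>l\<close> is the element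
  \<open>n - l\<close>.\<close>

definition T :: "nat \<Rightarrow> real \<Rightarrow> real" where
  "T i f = (\<Sum>l<i. real (n - l)) + f * real (n - i)"

definition srcs :: "nat \<Rightarrow> real \<Rightarrow> (real \<times> real) list" where
  "srcs i f = ((1 - f) * real (n - i), 1 - f) # map (\<lambda>l. (real (n - l), 1)) [Suc i..<n]"

definition tgts :: "nat \<Rightarrow> real \<Rightarrow> nat \<Rightarrow> (real \<times> real) list" where
  "tgts i f m = (real m * s - T i f, real (V m) - (real i + f)) # map (\<lambda>j. (s, real (v j))) [m..<k]"

lemma s_pos: "0 < s"
proof -
  have "0 < real k * s"
    unfolding s_eq using n_pos by (intro divide_pos_pos) (auto intro: add_pos_nonneg)
  then show ?thesis
    by (simp add: zero_less_mult_iff)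
qed

lemma v_pos: "j < k \<Longrightarrow> 0 < v j"
  using v_ge[of j] n_pos c_pos by (metis mult_pos_pos of_nat_0_less_iff order_less_le_trans)

lemma V_mono: "m \<le> m' \<Longrightarrow> V m \<le> V m'"
  unfolding V_def by (intro sum_mono2) auto

lemma V_k: "V k = n"
  by (simp add: V_def v_sum)

lemma V_Suc: "V (Suc m) = V m + v m"
  by (simp add: V_def)

lemma c_le_1: "c \<le> 1"
proof -
  have "c * n \<le> v 0"
    using v_ge k_pos by simp
  also have "v 0 \<le> n"
    using V_mono[of "Suc 0" k] V_k k_pos by (simp add: V_Suc V_def)
  finally show ?thesis
    using n_pos by simp
qed

lemma T_n: "T n 0 = k * s"
proof -
  have "T n 0 = real (\<Sum>l<n. n - l)"
    by (simp add: T_def)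
  also have "(\<Sum>l<n. n - l) = (\<Sum>l<n. Suc l)"
    by (subst sum.nat_diff_reindex[symmetric]) (auto intro: sum.cong)
  also have "real (\<Sum>l<n. Suc l) = n * (n + 1) / 2"
    by (induction n) (auto simp: field_simps)
  finally show ?thesis
    by (simp add: s_eq)
qed

text \<open>Elements are poured in decreasing order, so each unit of volume still to come carries at
  most \<open>n - i\<close>.\<close>

lemma T_concave:
  assumes "i \<le> W"
  shows "T W 0 - T i f \<le> (real W - (real i + f)) * real (n - i)"
proof -
  have "{..<W} = {..<i} \<union> {i..<W}"
    using assms by auto
  then have "(\<Sum>l<W. real (n - l)) = (\<Sum>l<i. real (n - l)) + (\<Sum>l=i..<W. real (n - l))"
    by (simp add: sum.union_disjoint ivl_disj_int)
  moreover have "(\<Sum>l=i..<W. real (n - l)) \<le> (\<Sum>l=i..<W. real (n - i))"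
    by (intro sum_mono) auto
  ultimately show ?thesis
    using assms by (simp add: T_def algebra_simps)
qed

text \<open>The state \<open>(i, f, m)\<close> of the recursion has \<open>i\<close> sources used up, the fraction
  \<open>f\<close> of the next one poured, and the first \<open>m\<close> targets merged; \<open>T i f\<close> is what has been poured so far.
  The last inequality says that the merged target is at least as dense as the next one.\<close>

definition state :: "nat \<Rightarrow> real \<Rightarrow> nat \<Rightarrow> bool" where
  "state i f m \<longleftrightarrow> i < n \<and> 0 \<le> f \<and> f \<le> 1 \<and> 1 \<le> m \<and> m \<le> k \<and>
     (m < k \<longrightarrow> real i + f < real (V m) \<and> (real (V m) - (real i + f)) * s \<le> (m * s - T i f) * v m)"

text \<open>Write g for the remaining volume of the merged target. The remaining sum is at least g *
  s / v m by the density order, and the slack together with \<open>T_concave\<close> bounds it by g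
  * (n - i) - c * n^2. Comparing the two gives both claims: the current source is denser than the
  next target, which makes the denominator in the pouring fraction positive, and g is linear in
  n.\<close>

lemma state_gap:
  assumes "state i f m" "m < k"
  shows "s < real (n - i) * v m" and "c * n \<le> real (V m) - (real i + f)"
proof -
  let ?g = "real (V m) - (real i + f)"
  have st: "real i + f < real (V m)" "?g * s \<le> (m * s - T i f) * v m" "0 \<le> f" "1 \<le> m"
    using assms by (auto simp: state_def)
  have vm: "0 < real (v m)"
    using v_pos assms by simp
  have "i \<le> V m"
    using st by linarith
  then have "T (V m) 0 - T i f \<le> ?g * real (n - i)"
    by (rule T_concave)
  moreover have "m * s + c * n ^ 2 \<le> T (V m) 0"
    using prefix_slack[of m] st assms by (simp add: T_def V_def)
  ultimately have 1: "(m * s - T i f) + c * n ^ 2 \<le> ?g * real (n - i)"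
    by linarith
  have 2: "?g * (s / v m) \<le> m * s - T i f"
    using st(2) vm by (simp add: field_simps)
  have "0 < c * n ^ 2"
    using c_pos n_pos by simp
  with 1 2 have "?g * (s / v m) < ?g * real (n - i)"
    by linarith
  then have "s / v m < real (n - i)"
    by (rule mult_left_less_imp_less) (use st in simp)
  then show "s < real (n - i) * v m"
    using vm by (simp add: field_simps)
  have "0 \<le> ?g * (s / v m)"
    using st(1) s_pos vm by simp
  then have "c * n ^ 2 \<le> ?g * real (n - i)"
    using 1 2 by linarith
  also have "\<dots> \<le> ?g * n"
    using st(1) by (intro mult_left_mono) auto
  finally show "c * n \<le> ?g"
    using n_pos by (simp add: power2_eq_square)
qed

text \<open>A used-up source and an untouched next one describe the same poured amount. The next
  source exists because the merged target still has room and \<open>V m\<close> is at most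
  \<open>n\<close>.\<close>

lemma mixing_drop_step:
  assumes "state i 1 m" "m < k"
  shows "state (Suc i) 0 m" and "srcs i 1 = (0, 0) # srcs (Suc i) 0"
    and "tgts i 1 m = tgts (Suc i) 0 m"
proof -
  have "real (Suc i) < V m"
    using assms by (auto simp: state_def)
  then have i: "Suc i < n"
    using V_mono[of m k] V_k assms(2) by linarith
  have T: "T i 1 = T (Suc i) 0"
    by (simp add: T_def)
  then show "state (Suc i) 0 m" "tgts i 1 m = tgts (Suc i) 0 m"
    using assms i by (auto simp: state_def tgts_def algebra_simps)
  show "srcs i 1 = (0, 0) # srcs (Suc i) 0"
    using i by (simp add: srcs_def upt_conv_Cons)
qed

text \<open>Merging keeps the common density s / v m. The targets are sorted by size, so the density
  s / v (m + 1) of the following one is no larger.\<close>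

lemma mixing_merge_step:
  assumes "state i f m" "m < k" "(m * s - T i f) / (real (V m) - (real i + f)) = s / v m"
  shows "state i f (Suc m)"
proof -
  have g: "0 < real (V m) - (real i + f)"
    using assms by (auto simp: state_def)
  have vm: "0 < real (v m)"
    using v_pos assms by simp
  have eq: "(m * s - T i f) * v m = s * (real (V m) - (real i + f))"
    using assms(3) g vm by (simp add: field_simps)
  have "(real (V (Suc m)) - (real i + f)) * s \<le> (Suc m * s - T i f) * v (Suc m)" if "Suc m < k"
  proof -
    have "(Suc m * s - T i f) * v m = s * (real (V (Suc m)) - (real i + f))"
      using eq by (simp add: V_Suc algebra_simps)
    moreover have "0 \<le> Suc m * s - T i f"
    proof -
      have "0 \<le> (m * s - T i f) * v m"
        using eq g s_pos by simp
      then have "0 \<le> m * s - T i f"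
        using vm by (simp add: zero_le_mult_iff)
      then show ?thesis
        using s_pos by (simp add: algebra_simps)
    qed
    then have "(Suc m * s - T i f) * v m \<le> (Suc m * s - T i f) * v (Suc m)"
      using v_mono[of m "Suc m"] that by (intro mult_left_mono) auto
    ultimately show ?thesis
      by (simp add: mult.commute)
  qed
  then show ?thesis
    using assms v_pos[of m] by (auto simp: state_def V_Suc)
qed

text \<open>The third term of the minimum is the fraction at which the two leading densities become
  equal, so pouring no more than that keeps their order. The second term is never attained, hence
  each pour ends with an empty source or with equal densities.\<close>

lemma mixing_pour_step:
  fixes b1 v1 a1 u1 l f' :: real
  assumes st: "state i f m" "m < k" "f \<noteq> 1"
  defines "b1 \<equiv> m * s - T i f" and "v1 \<equiv> real (V m) - (real i + f)"
  defines "a1 \<equiv> (1 - f) * real (n - i)" and "u1 \<equiv> 1 - f"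
  defines "l \<equiv> min 1 (min (v1 / u1) ((b1 * v m - v1 * s) / (a1 * v m - u1 * s)))"
  defines "f' \<equiv> f + l * (1 - f)"
  shows "state i f' m" and "0 \<le> l" and "l \<le> 1"
    and "srcs i f' = (a1 - l * a1, u1 - l * u1) # map (\<lambda>l. (real (n - l), 1)) [Suc i..<n]"
    and "tgts i f' m = (b1 - l * a1, v1 - l * u1) # map (\<lambda>j. (s, real (v j))) [m..<k]"
    and "f' = 1 \<or> (m * s - T i f') / (real (V m) - (real i + f')) = s / v m"
proof -
  have st': "i < n" "0 \<le> f" "f < 1" "1 \<le> m" "0 < v1" "v1 * s \<le> b1 * v m"
    using st by (auto simp: state_def b1_def v1_def)
  have vm: "0 < real (v m)"
    using v_pos st by simp
  have u1: "0 < u1" "u1 \<le> 1"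
    using st' by (auto simp: u1_def)
  let ?den = "a1 * v m - u1 * s" and ?num = "b1 * v m - v1 * s"
  have "?den = u1 * (real (n - i) * v m - s)"
    by (simp add: a1_def u1_def algebra_simps)
  moreover have "0 < real (n - i) * v m - s"
    using state_gap(1)[OF st(1,2)] by simp
  ultimately have den: "0 < ?den"
    using u1 by simp
  have num: "0 \<le> ?num"
    using st' by simp
  show l0: "0 \<le> l" and l1: "l \<le> 1"
    using den num u1 st' by (auto simp: l_def)
  have T': "T i f' = T i f + l * a1"
    unfolding T_def f'_def a1_def by algebra
  show "srcs i f' = (a1 - l * a1, u1 - l * u1) # map (\<lambda>l. (real (n - l), 1)) [Suc i..<n]"
    by (simp add: srcs_def a1_def u1_def f'_def algebra_simps)
  have b': "m * s - T i f' = b1 - l * a1" and v': "real (V m) - (real i + f') = v1 - l * u1"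
    unfolding T' b1_def v1_def u1_def by (simp_all add: f'_def algebra_simps)
  then show "tgts i f' m = (b1 - l * a1, v1 - l * u1) # map (\<lambda>j. (s, real (v j))) [m..<k]"
    unfolding tgts_def by simp
  have "l \<le> v1 / u1"
    by (simp add: l_def)
  then have v1': "0 \<le> v1 - l * u1"
    using u1 by (simp add: field_simps)
  have "l \<le> ?num / ?den"
    by (simp add: l_def)
  then have "l * ?den \<le> ?num"
    using den by (simp only: pos_le_divide_eq)
  then have num': "(v1 - l * u1) * s \<le> (b1 - l * a1) * v m"
    by (simp add: algebra_simps)
  have f': "0 \<le> f'" "f' \<le> 1"
  proof -
    have "f' \<le> f + 1 * (1 - f)"
      unfolding f'_def using l1 st' by (intro add_left_mono mult_right_mono) auto
    then show "f' \<le> 1"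
      by simp
    show "0 \<le> f'"
      using st' l0 by (simp add: f'_def)
  qed
  \<comment> \<open>If the volume ran out, the density order would force a nonnegative remaining
    sum. But then the poured volume is \<open>V m\<close>, and by the slack the \<open>V m\<close>
    largest elements sum to more than \<open>m * s\<close>.\<close>
  have v1'_pos: "0 < v1 - l * u1"
  proof (rule ccontr)
    assume "\<not> ?thesis"
    with v1' have 0: "v1 - l * u1 = 0"
      by simp
    then have "0 \<le> (b1 - l * a1) * v m"
      using num' by simp
    then have "0 \<le> b1 - l * a1"
      using vm by (simp add: zero_le_mult_iff)
    moreover have "i \<le> V m"
      using 0 v' f' by linarith
    then have "T (V m) 0 - T i f' \<le> 0"
      using T_concave[of i "V m" f'] v' 0 by simp
    moreover have "m * s + c * n ^ 2 \<le> T (V m) 0"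
      using prefix_slack[of m] st' st by (simp add: T_def V_def)
    moreover have "0 < c * n ^ 2"
      using c_pos n_pos by simp
    ultimately show False
      using b' by linarith
  qed
  show "state i f' m"
    using st st' f' num' v1'_pos b' v' by (auto simp: state_def)
  show "f' = 1 \<or> (m * s - T i f') / (real (V m) - (real i + f')) = s / v m"
  proof (cases "l = 1")
    case True
    then show ?thesis by (simp add: f'_def)
  next
    case False
    have "l \<noteq> v1 / u1"
      using v1'_pos u1 by (auto simp: field_simps)
    with False have "l = ?num / ?den"
      by (auto simp: l_def min_def split: if_splits)
    then have "l * ?den = ?num"
      using den by simp
    then have "(b1 - l * a1) * v m = s * (v1 - l * u1)"
      by (simp add: algebra_simps)
    then show ?thesis
      unfolding b' v' using v1'_pos vm by (simp add: frac_eq_eq)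
  qed
qed

lemma mixing_last:
  assumes "i < n"
  shows "fractional_solution (srcs i f) (tgts i f k) (map (\<lambda>_. [1]) (srcs i f))"
proof -
  have "sum_list (map snd (srcs i f)) = real (V k) - (real i + f)"
    using assms by (simp add: srcs_def o_def V_k sum_list_triv of_nat_diff)
  moreover have "sum_list (map fst (srcs i f)) = k * s - T i f"
  proof -
    have "sum_list (map fst (srcs i f)) = (1 - f) * real (n - i) + (\<Sum>l=Suc i..<n. real (n - l))"
      by (simp add: srcs_def o_def interv_sum_list_conv_sum_set_nat)
    moreover have "(\<Sum>l<n. real (n - l)) = (\<Sum>l<Suc i. real (n - l)) + (\<Sum>l=Suc i..<n. real (n - l))"
      using sum.atLeastLessThan_concat[of 0 "Suc i" n "\<lambda>l. real (n - l)"] assms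
      by (simp add: atLeast0LessThan del: sum.lessThan_Suc)
    ultimately show ?thesis
      by (simp add: T_n[symmetric]) (simp add: T_def algebra_simps)
  qed
  ultimately show ?thesis
    unfolding tgts_def by (simp add: fractional_solution_single sum_nth_sum_list)
qed

lemma length_srcs: "i < n \<Longrightarrow> length (srcs i f) = n - i"
  by (simp add: srcs_def)

lemma length_tgts: "length (tgts i f m) = Suc (k - m)"
  by (simp add: tgts_def)

text \<open>Rows from \<open>V (k - 1)\<close> on are untouched by drops and pours as long as two
  targets are left. They start as \<open>[1]\<close> in the final single-target problem, and undoing
  a merge multiplies the split entry by a proportion of at least \<open>c\<close>, hence the power
  of \<open>c\<close> with one factor per merge.\<close>

lemma fluid_mixing_state:
  assumes "state i f m"
  shows "\<exists>x. fluid_mixing (srcs i f) (tgts i f m) = Some x \<and>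
    fractional_solution (srcs i f) (tgts i f m) x \<and>
    (\<forall>l j. V (k - 1) \<le> l \<longrightarrow> i \<le> l \<longrightarrow> l < n \<longrightarrow> j < Suc (k - m) \<longrightarrow> c ^ (k - m) \<le> x ! (l - i) ! j)"
  using assms
\<comment> \<open>A drop or a merge lowers the doubled part by 2. A pour leaves it alone but makes
  the next step a drop or a merge, which the last summand records.\<close>
proof (induction "2 * ((n - i) + (k - m)) +
    (if f = 1 \<or> (m * s - T i f) / (real (V m) - (real i + f)) = s / v m then 0 else (1::nat))"
    arbitrary: i f m rule: less_induct)
  case less
  note st = \<open>state i f m\<close>
  note IH = less.hyps
  have i: "i < n" "0 \<le> f" "f \<le> 1" "1 \<le> m" "m \<le> k"
    using st by (auto simp: state_def)
  show ?case
  proof (cases "m = k")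
    case True
    have "fluid_mixing (srcs i f) (tgts i f k) = Some (map (\<lambda>_. [1]) (srcs i f))"
      by (subst fluid_mixing.simps) (simp add: tgts_def)
    then show ?thesis
      using mixing_last[OF i(1), of f] True length_srcs[OF i(1), of f]
      by (intro exI[of _ "map (\<lambda>_. [1]) (srcs i f)"]) auto
  next
    case False
    then have mk: "m < k" using i by simp
    have tg: "tgts i f m = (m * s - T i f, real (V m) - (real i + f)) # (s, real (v m)) # map (\<lambda>j. (s, real (v j))) [Suc m..<k]"
      using mk by (simp add: tgts_def upt_conv_Cons)
    have gap: "0 < real (V m) - (real i + f)"
      using st mk by (auto simp: state_def)
    \<comment> \<open>The current source lies strictly before the protected rows, so rewriting the
      head row cannot affect the lower bound.\<close>
    have iV: "i < V (k - 1)"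
      using gap i V_mono[of m "k - 1"] mk by linarith
    show ?thesis
    proof (cases "f = 1")
      case True
      note step = mixing_drop_step[OF st[unfolded True] mk]
      have less_meas: "2 * (n + k - Suc (i + m)) + (if B then 0 else 1) < 2 * (n + k - (i + m))" for B
        using i by auto
      obtain x where x: "fluid_mixing (srcs (Suc i) 0) (tgts (Suc i) 0 m) = Some x"
        "fractional_solution (srcs (Suc i) 0) (tgts (Suc i) 0 m) x"
        "\<And>l j. V (k - 1) \<le> l \<Longrightarrow> Suc i \<le> l \<Longrightarrow> l < n \<Longrightarrow> j < Suc (k - m) \<Longrightarrow> c ^ (k - m) \<le> x ! (l - Suc i) ! j"
        using IH[OF _ step(1)] True i less_meas by auto
      let ?x = "(1 # replicate (length (tgts i 1 m) - 1) 0) # x"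
      have "fluid_mixing (srcs i 1) (tgts i 1 m) = Some ?x"
        using x(1) unfolding step(2)
        by (subst fluid_mixing.simps) (simp add: step(3)[symmetric], simp add: tg[unfolded True])
      moreover have "fractional_solution (srcs i 1) (tgts i 1 m) ?x"
        unfolding step(2,3) using x(2) by (intro fractional_solution_drop_source) (auto simp: tgts_def)
      moreover have "c ^ (k - m) \<le> ?x ! (l - i) ! j"
        if "V (k - 1) \<le> l" "i \<le> l" "l < n" "j < Suc (k - m)" for l j
        using x(3)[of l j] that iV by (simp add: nth_Cons' )
      ultimately show ?thesis
        unfolding True by blast
    next
      case f1: False
      have srcs_eq: "srcs i f = ((1 - f) * real (n - i), 1 - f) # map (\<lambda>l. (real (n - l), 1)) [Suc i..<n]"
        by (simp add: srcs_def)
      show ?thesis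
      proof (cases "(m * s - T i f) / (real (V m) - (real i + f)) = s / v m")
        case True
        note step = mixing_merge_step[OF st mk True]
        have less_meas: "2 * (n - i + k - Suc m) + (if B then 0 else 1) < 2 * (n - i + k - m)" for B
          using mk by auto
        obtain x where x: "fluid_mixing (srcs i f) (tgts i f (Suc m)) = Some x"
          "fractional_solution (srcs i f) (tgts i f (Suc m)) x"
          "\<And>l j. V (k - 1) \<le> l \<Longrightarrow> i \<le> l \<Longrightarrow> l < n \<Longrightarrow> j < Suc (k - Suc m) \<Longrightarrow> c ^ (k - Suc m) \<le> x ! (l - i) ! j"
          using IH[OF _ step] True mk less_meas by auto
        define b1 v1 where "b1 = m * s - T i f" and "v1 = real (V m) - (real i + f)"
        define g where "g = v1 / (v1 + v m)"
        have tg': "tgts i f (Suc m) = (b1 + s, v1 + v m) # map (\<lambda>j. (s, real (v j))) [Suc m..<k]"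
          by (simp add: tgts_def b1_def v1_def V_Suc algebra_simps)
        note tg1 = tg[folded b1_def v1_def]
        have v1: "0 < v1" "0 < real (v m)"
          using gap v_pos mk by (auto simp: v1_def)
        have "fluid_mixing (srcs i f) (tgts i f m) = Some (map (split_first g) x)"
          using x(1) f1 v1 True unfolding tg1 tg' srcs_eq
          by (subst fluid_mixing.simps) (simp add: g_def b1_def v1_def)
        moreover have "fractional_solution (srcs i f) (tgts i f m) (map (split_first g) x)"
          unfolding tg1
        proof (rule fractional_solution_merge)
          show "fractional_solution (srcs i f) ((b1 + s, v1 + v m) # map (\<lambda>j. (s, real (v j))) [Suc m..<k]) x"
            using x(2) by (simp add: tg')
          show "0 \<le> g" "g \<le> 1" "v1 = g * (v1 + v m)"
            using v1 by (auto simp: g_def)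
          have "b1 * v m = s * v1"
            using True v1 unfolding b1_def[symmetric] v1_def[symmetric] by (simp add: field_simps)
          then show "b1 = g * (b1 + s)"
            using v1 by (simp add: g_def field_simps)
        qed
        moreover have "c ^ (k - m) \<le> map (split_first g) x ! (l - i) ! j"
          if l: "V (k - 1) \<le> l" "i \<le> l" "l < n" "j < Suc (k - m)" for l j
        proof -
          have len: "l - i < length x" "length (x ! (l - i)) = Suc (k - Suc m)"
            using x(2) l length_srcs[OF i(1)] by (auto simp: fractional_solution_def length_tgts)
          then have ne: "x ! (l - i) \<noteq> []" by auto
          have km: "k - m = Suc (k - Suc m)" using mk by simp
          have tot: "v1 + v m \<le> n"
            using V_mono[of "Suc m" k] mk i by (simp add: v1_def V_k V_Suc)
          \<comment> \<open>Both parts of the merged target have volume at least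
            \<open>c * n\<close>, and together at most \<open>n\<close>.\<close>
          have cg: "c \<le> g" "c \<le> 1 - g"
          proof -
            have "c * (v1 + v m) \<le> c * n"
              using tot c_pos by simp
            moreover have "c * n \<le> v1"
              using state_gap(2)[OF st mk] by (simp add: v1_def)
            moreover have "c * n \<le> v m"
              using v_ge mk by simp
            ultimately have "c * (v1 + v m) \<le> v1" "c * (v1 + v m) \<le> v m"
              by linarith+
            moreover have "1 - g = v m / (v1 + v m)"
              using v1 by (simp add: g_def field_simps)
            ultimately show "c \<le> g" "c \<le> 1 - g"
              using v1 by (simp_all add: g_def pos_le_divide_eq)
          qed
          have old: "c ^ (k - Suc m) \<le> x ! (l - i) ! j'" if "j' < Suc (k - Suc m)" for j'
            using x(3) l that by blast
          consider "j = 0" | "j = Suc 0" | j' where "j = Suc (Suc j')"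
            by (metis nat.exhaust)
          then show ?thesis
          proof cases
            case 1
            then show ?thesis
              using len c_pos cg mult_mono[OF cg(1) old[of 0]] by (simp add: split_first_nth[OF ne] km)
          next
            case 2
            then show ?thesis
              using len c_pos cg mult_mono[OF cg(2) old[of 0]] by (simp add: split_first_nth[OF ne] km)
          next
            case 3
            then have "c ^ (k - Suc m) \<le> x ! (l - i) ! Suc j'"
              using l by (intro old) auto
            moreover have "c ^ (k - m) \<le> c ^ (k - Suc m)"
              using c_pos c_le_1 by (intro power_decreasing) auto
            ultimately show ?thesis
              using len 3 by (simp add: split_first_nth[OF ne])
          qed
        qed
        ultimately show ?thesis
          by blast
      next
        case ne: False
        define b1 v1 a1 u1 where "b1 = m * s - T i f" and "v1 = real (V m) - (real i + f)"
          and "a1 = (1 - f) * real (n - i)" and "u1 = 1 - f"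
        define l where "l = min 1 (min (v1 / u1) ((b1 * v m - v1 * s) / (a1 * v m - u1 * s)))"
        define f' where "f' = f + l * u1"
        note step = mixing_pour_step[OF st mk f1, folded b1_def v1_def a1_def u1_def, folded l_def, folded f'_def]
        obtain x where x: "fluid_mixing (srcs i f') (tgts i f' m) = Some x"
          "fractional_solution (srcs i f') (tgts i f' m) x"
          "\<And>l j. V (k - 1) \<le> l \<Longrightarrow> i \<le> l \<Longrightarrow> l < n \<Longrightarrow> j < Suc (k - m) \<Longrightarrow> c ^ (k - m) \<le> x ! (l - i) ! j"
          using IH[OF _ step(1)] step(6) f1 ne by auto
        let ?x = "pour_row l (hd x) # tl x"
        note tg1 = tg[folded b1_def v1_def] and srcs1 = srcs_eq[folded a1_def u1_def]
        have ts: "map (\<lambda>j. (s, real (v j))) [m..<k] = (s, real (v m)) # map (\<lambda>j. (s, real (v j))) [Suc m..<k]"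
          using mk by (simp add: upt_conv_Cons)
        have "fluid_mixing (srcs i f) (tgts i f m) = Some ?x"
          using x(1) f1 gap ne unfolding tg1 srcs1 step(4,5) ts
          by (subst fluid_mixing.simps)
            (simp add: u1_def[symmetric] v1_def[symmetric] b1_def[symmetric] l_def[symmetric], simp add: u1_def)
        moreover have "fractional_solution (srcs i f) (tgts i f m) ?x"
          unfolding tg1 srcs1 using x(2) step(2,3) unfolding step(4,5) ts
          by (rule fractional_solution_pour)
        moreover have "c ^ (k - m) \<le> ?x ! (l - i) ! j"
          if "V (k - 1) \<le> l" "i \<le> l" "l < n" "j < Suc (k - m)" for l j
        proof -
          have "length x = n - i"
            using x(2) length_srcs[OF i(1)] by (auto simp: fractional_solution_def)
          then have "?x ! (l - i) = x ! (l - i)"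
            using that iV Suc_diff_Suc[of i l] by (simp add: nth_Cons' nth_tl)
          then show ?thesis
            using x(3)[of l j] that by simp
        qed
        ultimately show ?thesis
          by blast
      qed
    qed
  qed
qed

text \<open>Row \<open>l\<close> belongs to the element \<open>n - l\<close>, so the rows with the
  lower bound are those of the elements from 1 to \<open>v (k - 1)\<close>.\<close>

lemma fluid_mixing_instance:
  assumes s: "s = target_sum n k" and v: "\<And>j. j < k \<Longrightarrow> P ! j = v j"
  obtains x where "fluid_mixing (instance_sources n) (instance_targets n k P) = Some x"
    and "fractional_solution (instance_sources n) (instance_targets n k P) x"
    and "\<And>l j. n - v (k - 1) \<le> l \<Longrightarrow> l < n \<Longrightarrow> j < k \<Longrightarrow> c ^ (k - 1) \<le> x ! l ! j"
proof -
  have "instance_sources n = srcs 0 0"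
  proof -
    have "instance_sources n = map (\<lambda>l. (real (n - l), 1)) [0..<n]"
      by (rule nth_equalityI) (auto simp: instance_sources_def simp del: upt_Suc)
    then show ?thesis
      using n_pos by (simp add: srcs_def upt_conv_Cons del: upt_Suc)
  qed
  moreover have "instance_targets n k P = tgts 0 0 1"
  proof -
    have "instance_targets n k P = map (\<lambda>j. (s, real (v j))) [0..<k]"
      by (rule nth_equalityI) (auto simp: instance_targets_def s v simp del: upt_Suc)
    also have "\<dots> = tgts 0 0 1"
      using k_pos by (simp add: tgts_def upt_conv_Cons T_def V_def del: upt_Suc)
    finally show ?thesis .
  qed
  moreover have "state 0 0 1"
  proof -
    have "s * v 0 \<le> s * v (Suc 0)" if "Suc 0 < k"
      using v_mono[of 0 "Suc 0"] that s_pos by simp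
    then show ?thesis
      using n_pos k_pos v_pos[of 0] by (simp add: state_def V_def T_def mult.commute)
  qed
  moreover have "V (k - 1) = n - v (k - 1)"
    using V_Suc[of "k - 1"] k_pos V_k by simp
  ultimately show ?thesis
    using fluid_mixing_state[of 0 0 1] k_pos that by auto
qed

end

section \<open>Moves and swaps\<close>

definition partitions :: "nat \<Rightarrow> nat \<Rightarrow> (nat \<Rightarrow> nat set) \<Rightarrow> bool" where
  "partitions n k Q \<longleftrightarrow> (\<Union>j\<in>{1..k}. Q j) = {1..n} \<and> disjoint_family_on Q {1..k}"

text \<open>The common unit of both loops: a move is one transfer, a swap is two.\<close>

definition transfer :: "(nat \<Rightarrow> nat set) \<Rightarrow> nat \<Rightarrow> nat \<Rightarrow> nat \<Rightarrow> nat \<Rightarrow> nat set" where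
  "transfer Q a b z = Q(a := Q a - {z}, b := insert z (Q b))"

text \<open>Each counted \<open>z\<close> offers the swap of \<open>z + d\<close> from
  \<open>Q a\<close> against \<open>z\<close> from \<open>Q b\<close>, which shifts \<open>d\<close>
  from the sum of the first to that of the second. Restricting to a fixed \<open>Z\<close> keeps the
  pairs disjoint.\<close>

definition pair_count :: "nat set \<Rightarrow> nat \<Rightarrow> (nat \<Rightarrow> nat set) \<Rightarrow> nat \<Rightarrow> nat \<Rightarrow> nat" where
  "pair_count Z d Q a b = card {z \<in> Z. z \<in> Q b \<and> z + d \<in> Q a}"

lemma partitions_finite: "partitions n k Q \<Longrightarrow> j \<in> {1..k} \<Longrightarrow> finite (Q j)"
  by (rule finite_subset[of _ "{1..n}"]) (auto simp: partitions_def)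

lemma partitions_disjoint:
  "partitions n k Q \<Longrightarrow> a \<in> {1..k} \<Longrightarrow> b \<in> {1..k} \<Longrightarrow> a \<noteq> b \<Longrightarrow> z \<in> Q a \<Longrightarrow> z \<notin> Q b"
  unfolding partitions_def disjoint_family_on_def by blast

lemma partitions_sum_card:
  assumes "partitions n k Q"
  shows "(\<Sum>j\<in>{1..k}. card (Q j)) = n"
proof -
  have "card (\<Union>j\<in>{1..k}. Q j) = (\<Sum>j\<in>{1..k}. card (Q j))"
    using assms partitions_finite[OF assms]
    by (intro card_UN_disjoint) (auto simp: partitions_def disjoint_family_on_def)
  then show ?thesis
    using assms by (simp add: partitions_def)
qed

lemma partitions_sum_sum:
  assumes "partitions n k Q"
  shows "(\<Sum>j\<in>{1..k}. \<Sum>(Q j)) = \<Sum>{1..n}"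
proof -
  have "\<Sum>(\<Union>j\<in>{1..k}. Q j) = (\<Sum>j\<in>{1..k}. \<Sum>(Q j))"
    using assms partitions_finite[OF assms]
    by (intro sum.UNION_disjoint) (auto simp: partitions_def disjoint_family_on_def)
  then show ?thesis
    using assms by (simp add: partitions_def)
qed

context
  fixes n k Q a b z
  assumes Q: "partitions n k Q" and ab: "a \<in> {1..k}" "b \<in> {1..k}" "a \<noteq> b" and z: "z \<in> Q a"
begin

lemma partitions_transfer: "partitions n k (transfer Q a b z)"
proof -
  have "(\<Union>j\<in>{1..k}. transfer Q a b z j) = (\<Union>j\<in>{1..k}. Q j)"
    using ab z by (auto simp: transfer_def split: if_splits)
  moreover have "transfer Q a b z i \<inter> transfer Q a b z j = {}"
    if "i \<in> {1..k}" "j \<in> {1..k}" "i \<noteq> j" for i j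
  proof -
    have "Q i \<inter> Q j = {}" "i \<noteq> a \<Longrightarrow> z \<notin> Q i" "j \<noteq> a \<Longrightarrow> z \<notin> Q j"
      using that partitions_disjoint[OF Q] ab z by blast+
    then show ?thesis
      using that ab by (auto simp: transfer_def)
  qed
  ultimately show ?thesis
    using Q by (simp add: partitions_def disjoint_family_on_def)
qed

lemma card_transfer:
  assumes "j \<in> {1..k}"
  shows "int (card (transfer Q a b z j)) = int (card (Q j)) + of_bool (j = b) - of_bool (j = a)"
proof -
  have "z \<notin> Q b"
    using partitions_disjoint[OF Q ab z] .
  moreover have "card (Q a) \<ge> 1"
    using z partitions_finite[OF Q ab(1)] by (metis One_nat_def Suc_leI card_gt_0_iff empty_iff)
  ultimately show ?thesis
    using ab z partitions_finite[OF Q] assms by (auto simp: transfer_def card_Diff_singleton of_nat_diff)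
qed

lemma sum_transfer:
  assumes "j \<in> {1..k}"
  shows "int (\<Sum>(transfer Q a b z j)) = int (\<Sum>(Q j)) + z * of_bool (j = b) - z * of_bool (j = a)"
proof -
  have "z \<notin> Q b"
    using partitions_disjoint[OF Q ab z] .
  moreover have "\<Sum>(Q a) = z + \<Sum>(Q a - {z})"
    using z partitions_finite[OF Q ab(1)] by (rule sum.remove[rotated])
  ultimately show ?thesis
    using ab z partitions_finite[OF Q] assms by (auto simp: transfer_def simp del: of_nat_sum)
qed

end

lemma swap_eq_transfer:
  assumes "partitions n k Q" "a \<in> {1..k}" "b \<in> {1..k}" "a \<noteq> b" "z \<in> Q a" "w \<in> Q b"
  shows "Q(a := insert w (Q a - {z}), b := insert z (Q b - {w})) = transfer (transfer Q a b z) b a w"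
proof -
  have "z \<noteq> w"
    using partitions_disjoint[OF assms(1-5)] assms by auto
  then show ?thesis
    using assms by (auto simp: transfer_def fun_eq_iff)
qed

text \<open>A pair that is lost contains an element of \<open>W\<close>. Mapping it to such an
  element is injective because the pairs are disjoint.\<close>

lemma pair_count_change:
  assumes Z: "finite Z" "disjoint_family_on (\<lambda>z. {z, z + d}) Z" and W: "finite W"
    and same: "\<And>z. z \<notin> W \<Longrightarrow> z \<in> Q b \<Longrightarrow> z \<in> Q' b" "\<And>z. z \<notin> W \<Longrightarrow> z \<in> Q a \<Longrightarrow> z \<in> Q' a"
  shows "pair_count Z d Q a b \<le> pair_count Z d Q' a b + card W"
proof -
  let ?R = "{z \<in> Z. z \<in> W \<or> z + d \<in> W}"
  have "{z \<in> Z. z \<in> Q b \<and> z + d \<in> Q a} \<subseteq> {z \<in> Z. z \<in> Q' b \<and> z + d \<in> Q' a} \<union> ?R"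
    using same by auto
  then have "pair_count Z d Q a b \<le> card ({z \<in> Z. z \<in> Q' b \<and> z + d \<in> Q' a} \<union> ?R)"
    unfolding pair_count_def using Z(1) by (intro card_mono) auto
  also have "\<dots> \<le> pair_count Z d Q' a b + card ?R"
    unfolding pair_count_def by (rule card_Un_le)
  also have "card ?R \<le> card W"
  proof (rule card_inj_on_le)
    let ?h = "\<lambda>z. if z \<in> W then z else z + d"
    show "inj_on ?h ?R"
    proof (rule inj_onI)
      fix x y assume xy: "x \<in> ?R" "y \<in> ?R" "?h x = ?h y"
      then have "{x, x + d} \<inter> {y, y + d} \<noteq> {}"
        by (auto split: if_splits)
      then show "x = y"
        using Z(2) xy by (auto simp: disjoint_family_on_def)
    qed
  qed (use W in auto)
  finally show ?thesis by simp
qed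

lemma pair_count_transfer:
  assumes "finite Z" "disjoint_family_on (\<lambda>z. {z, z + d}) Z"
  shows "pair_count Z d Q i j \<le> pair_count Z d (transfer Q a b z) i j + 1"
proof -
  have "pair_count Z d Q i j \<le> pair_count Z d (transfer Q a b z) i j + card {z}"
    by (rule pair_count_change) (use assms in \<open>auto simp: transfer_def\<close>)
  then show ?thesis by simp
qed

text \<open>Used contrapositively: a configuration that has a successor, and none of whose
  successors can fail, cannot fail itself. Infinite executions are covered since their tails are
  infinite executions again.\<close>

lemma can_fail_cases:
  assumes "can_fail n k P c"
  shows "(\<exists>c'. rr_step n k P c c' \<and> can_fail n k P c') \<or>
    ((\<nexists>c'. rr_step n k P c c') \<and> \<not> (\<exists>Q. c = Returned Q \<and> solves n k P Q))"
  using assms[unfolded can_fail_def]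
proof (elim disjE exE conjE)
  fix c' assume c': "(rr_step n k P)\<^sup>*\<^sup>* c c'" "\<nexists>c''. rr_step n k P c' c''"
    "\<not> (\<exists>Q. c' = Returned Q \<and> solves n k P Q)"
  from c'(1) show ?thesis
  proof (cases rule: converse_rtranclpE)
    case base
    then show ?thesis using c' by auto
  next
    case (step y)
    then have "can_fail n k P y"
      using c' by (auto simp: can_fail_def)
    then show ?thesis using step by auto
  qed
next
  fix f assume f: "f 0 = c" "\<forall>i. rr_step n k P (f i) (f (Suc i))"
  then have "can_fail n k P (f (Suc 0))"
    unfolding can_fail_def by (intro disjI2 exI[of _ "\<lambda>i. f (Suc i)"]) auto
  then show ?thesis using f by metis
qed

lemma rr_step_MovingE:
  assumes "rr_step n k P (Moving Q) c"
  obtains (move) a b z where "a \<in> {1..k}" "b \<in> {1..k}" "card (Q a) > P ! (a - 1)" "card (Q b) < P ! (b - 1)"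
      "z \<in> Q a" "c = Moving (transfer Q a b z)"
  | (moving_done) "\<not> ((\<exists>a\<in>{1..k}. card (Q a) > P ! (a - 1)) \<and> (\<exists>b\<in>{1..k}. card (Q b) < P ! (b - 1)))" "c = Swapping Q"
  using assms by (cases rule: rr_step.cases) (auto simp: transfer_def)

lemma rr_step_SwappingE:
  assumes "rr_step n k P (Swapping Q) c"
  obtains (swap) a b z w where "\<exists>j\<in>{1..k}. real (\<Sum>(Q j)) \<noteq> target_sum n k" "extremal_sums k Q a b"
      "(z, w) \<in> swap_pairs n k Q a b"
      "\<forall>(y, y')\<in>swap_pairs n k Q a b. real y - real y' \<le> real z - real w"
      "c = Swapping (Q(a := insert w (Q a - {z}), b := insert z (Q b - {w})))"
  | (fail) a b where "\<exists>j\<in>{1..k}. real (\<Sum>(Q j)) \<noteq> target_sum n k" "extremal_sums k Q a b" "swap_pairs n k Q a b = {}"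
  | (swapping_done) "\<forall>j\<in>{1..k}. real (\<Sum>(Q j)) = target_sum n k" "c = Returned Q"
  using assms by (cases rule: rr_step.cases) blast+

inductive_cases rr_step_ReturnedE: "rr_step n k P (Returned Q) c"

lemma not_can_fail_Returned:
  assumes "solves n k P Q"
  shows "\<not> can_fail n k P (Returned Q)"
  using can_fail_cases assms by (blast elim: rr_step_ReturnedE)

section \<open>The two loops as a deterministic potential argument\<close>

locale repair =
  fixes n k :: nat and P :: "nat list" and t D :: nat and Z1 Z2 :: "nat set"
  assumes target: "target_sum n k = real t"
    and k_pos: "1 \<le> k"
    and P_sum: "(\<Sum>j\<in>{1..k}. P ! (j - 1)) = n"
    and D_pos: "1 \<le> D"
    and Z1: "finite Z1" "disjoint_family_on (\<lambda>z. {z, z + 1}) Z1"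
    and Z2: "finite Z2" "disjoint_family_on (\<lambda>z. {z, z + D}) Z2"
begin

definition dev :: "(nat \<Rightarrow> nat set) \<Rightarrow> nat \<Rightarrow> int" where
  "dev Q j = int (\<Sum>(Q j)) - int t"

definition pot :: "(nat \<Rightarrow> nat set) \<Rightarrow> int" where
  "pot Q = (\<Sum>j\<in>{1..k}. \<bar>dev Q j\<bar>)"

text \<open>The subtraction is truncated on purpose: only overfull sets count, so every move lowers
  the value by exactly 1.\<close>

definition excess :: "(nat \<Rightarrow> nat set) \<Rightarrow> nat" where
  "excess Q = (\<Sum>j\<in>{1..k}. card (Q j) - P ! (j - 1))"

text \<open>A swap with difference \<open>d\<close> lowers \<open>pot\<close> by \<open>2 * d\<close> and every pair count by at most 2. While
  \<open>pot\<close> exceeds \<open>2 * k * D\<close> a pair with difference \<open>D\<close> may be swapped, so that \<open>pot / D\<close>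
  decreases by 2; later \<open>pot\<close> itself does.\<close>

definition swap_inv :: "(nat \<Rightarrow> nat set) \<Rightarrow> bool" where
  "swap_inv Q \<longleftrightarrow> partitions n k Q \<and> (\<forall>j\<in>{1..k}. card (Q j) = P ! (j - 1)) \<and>
     (\<forall>a\<in>{1..k}. \<forall>b\<in>{1..k}. a \<noteq> b \<longrightarrow>
        pot Q + D * min (pot Q) (2 * k * D) < D * pair_count Z1 1 Q a b \<and>
        (pot Q \<le> 2 * k * D \<or> pot Q < D * pair_count Z2 D Q a b))"

text \<open>A move costs at most \<open>2 * n\<close> in \<open>pot\<close> and one pair in each
  count, and lowers \<open>excess\<close> by 1, so the terms with \<open>excess\<close> prepay all
  moves to come. The term \<open>D * (2 * k * D)\<close> bounds the minimum in
  \<open>swap_inv\<close>, which is what must hold when \<open>excess\<close> has reached 0.\<close>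

definition move_inv :: "(nat \<Rightarrow> nat set) \<Rightarrow> bool" where
  "move_inv Q \<longleftrightarrow> partitions n k Q \<and>
     (\<forall>a\<in>{1..k}. \<forall>b\<in>{1..k}. a \<noteq> b \<longrightarrow>
        pot Q + 2 * n * excess Q + D * excess Q + D * (2 * k * D) < D * pair_count Z1 1 Q a b \<and>
        pot Q + 2 * n * excess Q + D * excess Q < D * pair_count Z2 D Q a b)"

lemma sum_dev:
  assumes "partitions n k Q"
  shows "(\<Sum>j\<in>{1..k}. dev Q j) = 0"
proof -
  have "real k * real t = real n * (real n + 1) / 2"
    using target k_pos by (simp add: target_sum_def field_simps)
  then have "real (2 * k * t) = real (n * (n + 1))"
    by (simp add: field_simps)
  then have "2 * k * t = n * (n + 1)"
    by (simp only: of_nat_eq_iff)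
  moreover have "2 * \<Sum>{1..n} = n * (n + 1)"
    using gauss_sum_from_Suc_0[of n, where ?'a = nat] by (simp add: dvd_mult_div_cancel)
  ultimately have "\<Sum>{1..n} = k * t"
    by simp
  then have "(\<Sum>j\<in>{1..k}. \<Sum>(Q j)) = k * t"
    using partitions_sum_sum[OF assms] by simp
  then have "(\<Sum>j\<in>{1..k}. int (\<Sum>(Q j))) = int k * int t"
    by (metis of_nat_mult of_nat_sum)
  then show ?thesis
    by (simp add: dev_def sum_subtractf del: of_nat_sum)
qed

text \<open>The deviations sum to 0, so \<open>pot\<close> is twice the sum of the positive ones,
  hence at most \<open>2 * k\<close> times the largest; likewise for the negative ones.\<close>

lemma extremal_dev:
  assumes Q: "partitions n k Q" and ex: "extremal_sums k Q a b"
  shows "pot Q \<le> 2 * k * dev Q a" and "pot Q \<le> 2 * k * - dev Q b"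
proof -
  have le: "dev Q j \<le> dev Q a" "dev Q b \<le> dev Q j" if "j \<in> {1..k}" for j
    using ex that by (auto simp: extremal_sums_def dev_def simp del: of_nat_sum)
  have a0: "0 \<le> dev Q a"
  proof (rule ccontr)
    assume "\<not> ?thesis"
    then have "(\<Sum>j\<in>{1..k}. dev Q j) < (\<Sum>j\<in>{1..k}. 0)"
      using le k_pos by (intro sum_strict_mono) (force simp: not_le)+
    then show False using sum_dev[OF Q] by simp
  qed
  have b0: "dev Q b \<le> 0"
  proof (rule ccontr)
    assume "\<not> ?thesis"
    then have "(\<Sum>j\<in>{1..k}. 0) < (\<Sum>j\<in>{1..k}. dev Q j)"
      using le k_pos by (intro sum_strict_mono) (force simp: not_le)+
    then show False using sum_dev[OF Q] by simp
  qed
  have "pot Q = (\<Sum>j\<in>{1..k}. \<bar>dev Q j\<bar> + dev Q j)"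
    using sum_dev[OF Q] by (simp add: pot_def sum.distrib)
  also have "\<dots> \<le> (\<Sum>j\<in>{1..k}. 2 * dev Q a)"
    using le(1) a0 by (intro sum_mono) (smt (verit))
  finally show "pot Q \<le> 2 * k * dev Q a" by (simp add: mult.assoc)
  have "pot Q = (\<Sum>j\<in>{1..k}. \<bar>dev Q j\<bar> - dev Q j)"
    using sum_dev[OF Q] by (simp add: pot_def sum_subtractf)
  also have "\<dots> \<le> (\<Sum>j\<in>{1..k}. 2 * - dev Q b)"
    using le(2) b0 by (intro sum_mono) (smt (verit))
  finally show "pot Q \<le> 2 * k * - dev Q b" by simp
qed

lemma pot_nonneg: "0 \<le> pot Q"
  by (simp add: pot_def sum_nonneg)

lemma pot_pos:
  assumes "\<exists>j\<in>{1..k}. real (\<Sum>(Q j)) \<noteq> target_sum n k"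
  shows "0 < pot Q"
proof -
  obtain j where j: "j \<in> {1..k}" "real (\<Sum>(Q j)) \<noteq> real t"
    using assms target by auto
  then have "dev Q j \<noteq> 0"
    by (simp add: dev_def del: of_nat_sum)
  then have "0 < \<bar>dev Q j\<bar>" by simp
  also have "\<dots> \<le> pot Q"
    unfolding pot_def using j by (intro member_le_sum) auto
  finally show ?thesis .
qed

lemma extremal_exists: "\<exists>a b. extremal_sums k Q a b"
proof -
  have fin: "finite ((\<lambda>j. \<Sum>(Q j)) ` {1..k})" "(\<lambda>j. \<Sum>(Q j)) ` {1..k} \<noteq> {}"
    using k_pos by auto
  obtain a where "a \<in> {1..k}" "\<Sum>(Q a) = Max ((\<lambda>j. \<Sum>(Q j)) ` {1..k})"
    using Max_in[OF fin] by force
  moreover obtain b where "b \<in> {1..k}" "\<Sum>(Q b) = Min ((\<lambda>j. \<Sum>(Q j)) ` {1..k})"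
    using Min_in[OF fin] by force
  ultimately show ?thesis
    unfolding extremal_sums_def using Max_ge[OF fin(1)] Min_le[OF fin(1)] by (metis imageI)
qed

lemma swap_pairs_iff:
  "(z, w) \<in> swap_pairs n k Q a b \<longleftrightarrow> z \<in> Q a \<and> w \<in> Q b \<and> w < z \<and>
     int z - int w \<le> dev Q a \<and> int z - int w \<le> - dev Q b"
proof -
  have "real z - real w \<le> real (\<Sum>(Q a)) - real t \<longleftrightarrow> int z - int w \<le> dev Q a"
    "real z - real w \<le> real t - real (\<Sum>(Q b)) \<longleftrightarrow> int z - int w \<le> - dev Q b"
    unfolding dev_def by linarith+
  then show ?thesis
    by (auto simp: swap_pairs_def Let_def target simp del: of_nat_sum)
qed

text \<open>If \<open>pot\<close> exceeds \<open>2 * k * D\<close>, both extremal deviations exceed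
  \<open>D\<close> in absolute value and a pair from \<open>Z2\<close> is admissible. Otherwise they
  are still nonzero integers, and a pair from \<open>Z1\<close> is.\<close>

lemma swap_available:
  assumes inv: "swap_inv Q" and ne: "\<exists>j\<in>{1..k}. real (\<Sum>(Q j)) \<noteq> target_sum n k"
    and ex: "extremal_sums k Q a b"
  shows "a \<noteq> b" and "\<exists>z w. (z, w) \<in> swap_pairs n k Q a b \<and> (2 * k * D < pot Q \<longrightarrow> D \<le> int z - int w)"
proof -
  have Q: "partitions n k Q"
    using inv by (simp add: swap_inv_def)
  have ab: "a \<in> {1..k}" "b \<in> {1..k}"
    using ex by (auto simp: extremal_sums_def)
  have "0 < 2 * k * dev Q a" "0 < 2 * k * - dev Q b"
    using extremal_dev[OF Q ex] pot_pos[OF ne] by linarith+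
  then have pos: "0 < dev Q a" "0 < - dev Q b"
    by (simp_all add: zero_less_mult_iff mult_less_0_iff)
  then show "a \<noteq> b" by auto
  then have inv': "pot Q + D * min (pot Q) (2 * k * D) < D * pair_count Z1 1 Q a b"
    "pot Q \<le> 2 * k * D \<or> pot Q < D * pair_count Z2 D Q a b"
    using inv ab by (auto simp: swap_inv_def)
  have pair: "\<exists>w. w \<in> Q b \<and> w + d \<in> Q a" if "0 < pair_count Z d Q a b" for Z d
    using that by (auto simp: pair_count_def card_gt_0_iff)
  show "\<exists>z w. (z, w) \<in> swap_pairs n k Q a b \<and> (2 * k * D < pot Q \<longrightarrow> D \<le> int z - int w)"
  proof (cases "2 * k * D < pot Q")
    case True
    then have "pot Q < D * pair_count Z2 D Q a b"
      using inv' by auto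
    then have "0 < pair_count Z2 D Q a b"
      using pot_nonneg[of Q] by (intro gr0I) auto
    then obtain w where w: "w \<in> Q b" "w + D \<in> Q a"
      using pair by blast
    have "int (2 * k) * int D < int (2 * k) * dev Q a" "int (2 * k) * int D < int (2 * k) * - dev Q b"
      using True extremal_dev[OF Q ex] unfolding of_nat_mult[of "2 * k" D] by linarith+
    then have "D \<le> dev Q a" "D \<le> - dev Q b"
      using k_pos by (simp_all only: mult_less_cancel_left) auto
    then show ?thesis
      using w D_pos by (intro exI[of _ "w + D"] exI[of _ w]) (auto simp: swap_pairs_iff)
  next
    case False
    have "0 \<le> D * min (pot Q) (2 * k * D)"
      using pot_nonneg[of Q] by simp
    then have "0 < D * pair_count Z1 1 Q a b"
      using inv'(1) pot_nonneg[of Q] by linarith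
    then have "0 < pair_count Z1 1 Q a b"
      by (intro gr0I) auto
    then obtain w where w: "w \<in> Q b" "w + 1 \<in> Q a"
      using pair by blast
    then show ?thesis
      using False pos by (intro exI[of _ "w + 1"] exI[of _ w]) (auto simp: swap_pairs_iff)
  qed
qed

text \<open>The bound \<Delta> keeps the two deviations from changing sign, so \<open>pot\<close>
  falls by exactly twice the difference, while two transfers cost at most two pairs of each
  kind.\<close>

lemma swap_preserves:
  assumes inv: "swap_inv Q" and ne: "\<exists>j\<in>{1..k}. real (\<Sum>(Q j)) \<noteq> target_sum n k"
    and ex: "extremal_sums k Q a b"
    and zw: "(z, w) \<in> swap_pairs n k Q a b"
    and mx: "\<forall>(z', w')\<in>swap_pairs n k Q a b. real z' - real w' \<le> real z - real w"
  defines "Q' \<equiv> Q(a := insert w (Q a - {z}), b := insert z (Q b - {w}))"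
  shows "swap_inv Q'" and "pot Q' < pot Q"
proof -
  have Q: "partitions n k Q"
    using inv by (simp add: swap_inv_def)
  have ab: "a \<in> {1..k}" "b \<in> {1..k}"
    using ex by (auto simp: extremal_sums_def)
  have a_b: "a \<noteq> b" "b \<noteq> a"
    using swap_available(1)[OF inv ne ex] by auto
  have zw': "z \<in> Q a" "w \<in> Q b" "w < z" "int z - int w \<le> dev Q a" "int z - int w \<le> - dev Q b"
    using zw by (auto simp: swap_pairs_iff)
  define R where "R = transfer Q a b z"
  have Q'_eq: "Q' = transfer R b a w"
    unfolding Q'_def R_def by (rule swap_eq_transfer) (use Q ab a_b zw' in auto)
  have R: "partitions n k R"
    unfolding R_def by (rule partitions_transfer) (use Q ab a_b zw' in auto)
  have w: "w \<in> R b"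
    using zw' by (simp add: R_def transfer_def)
  have Q': "partitions n k Q'"
    unfolding Q'_eq by (rule partitions_transfer) (use R ab a_b w in auto)
  have card: "card (Q' j) = card (Q j)" if "j \<in> {1..k}" for j
    using card_transfer[OF R ab(2,1) a_b(2) w that] card_transfer[OF Q ab a_b(1) zw'(1) that]
    unfolding Q'_eq R_def by simp
  let ?d = "int z - int w"
  have dev: "\<bar>dev Q' j\<bar> = \<bar>dev Q j\<bar> - ?d * of_bool (j = a) - ?d * of_bool (j = b)" if "j \<in> {1..k}" for j
    using sum_transfer[OF R ab(2,1) a_b(2) w that] sum_transfer[OF Q ab a_b(1) zw'(1) that] zw' a_b
    unfolding Q'_eq R_def dev_def by (auto simp del: of_nat_sum)
  have "pot Q' = (\<Sum>j\<in>{1..k}. \<bar>dev Q j\<bar> - ?d * of_bool (j = a) - ?d * of_bool (j = b))"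
    unfolding pot_def using dev by (intro sum.cong) auto
  also have "\<dots> = pot Q - ?d * (\<Sum>j\<in>{1..k}. of_bool (j = a)) - ?d * (\<Sum>j\<in>{1..k}. of_bool (j = b))"
    by (simp add: sum_subtractf pot_def sum_distrib_left)
  finally have pot: "pot Q' = pot Q - 2 * ?d"
    using ab by simp
  then show "pot Q' < pot Q"
    using zw' by simp
  \<comment> \<open>The chosen pair need not come from \<open>Z2\<close>; its difference is maximal,
    and an admissible pair with difference at least \<open>D\<close> exists.\<close>
  have d_ge: "D \<le> ?d" if "2 * k * D < pot Q"
    using swap_available(2)[OF inv ne ex] mx that by fastforce
  have d1: "1 \<le> ?d"
    using zw' by simp
  have count: "pair_count Z d Q i j \<le> pair_count Z d Q' i j + 2"
    if "finite Z" "disjoint_family_on (\<lambda>z. {z, z + d}) Z" for Z d i j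
    using pair_count_transfer[OF that, of Q i j a b z] pair_count_transfer[OF that, of R i j b a w]
    by (simp add: Q'_eq R_def)
  have "pot Q' + D * min (pot Q') (2 * k * D) < D * pair_count Z1 1 Q' i j \<and>
        (pot Q' \<le> 2 * k * D \<or> pot Q' < D * pair_count Z2 D Q' i j)"
    if ij: "i \<in> {1..k}" "j \<in> {1..k}" "i \<noteq> j" for i j
  proof -
    have inv': "pot Q + D * min (pot Q) (2 * k * D) < D * pair_count Z1 1 Q i j"
      "pot Q \<le> 2 * k * D \<or> pot Q < D * pair_count Z2 D Q i j"
      using inv ij by (auto simp: swap_inv_def)
    have "int (pair_count Z1 1 Q i j) \<le> int (pair_count Z1 1 Q' i j + 2)"
      "int (pair_count Z2 D Q i j) \<le> int (pair_count Z2 D Q' i j + 2)"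
      unfolding of_nat_le_iff by (intro count Z1 Z2)+
    then have c: "int D * pair_count Z1 1 Q i j \<le> int D * (pair_count Z1 1 Q' i j + 2)"
      "int D * pair_count Z2 D Q i j \<le> int D * (pair_count Z2 D Q' i j + 2)"
      by (intro mult_left_mono; simp)+
    show ?thesis
    proof (cases "2 * k * D < pot Q")
      case True
      have "int D * min (pot Q') (2 * k * D) \<le> D * min (pot Q) (2 * k * D)"
        using pot d1 by (intro mult_left_mono) auto
      moreover have "pot Q < D * pair_count Z2 D Q i j"
        using inv'(2) True by linarith
      \<comment> \<open>The products with \<open>D\<close> become plain variables here, which leaves
        linear arithmetic.\<close>
      moreover have combine: "p' + m' < x' \<and> (B \<or> p' < y')"
        if "m' \<le> m" "p < y" "p + m < x" "x \<le> x' + 2 * D" "y \<le> y' + 2 * D" "p' = p - 2 * d" "D \<le> d"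
        for p p' m m' x x' y y' d :: int and B
        using that by linarith
      moreover have "int (D * pair_count Z1 1 Q i j) \<le> int (D * pair_count Z1 1 Q' i j) + 2 * D"
        "int (D * pair_count Z2 D Q i j) \<le> int (D * pair_count Z2 D Q' i j) + 2 * D"
        using c by (simp_all add: algebra_simps)
      ultimately show ?thesis
        by (intro combine[OF _ _ inv'(1) _ _ pot d_ge[OF True]])
    next
      case False
      then have m: "min (pot Q') (2 * k * D) = pot Q - 2 * ?d" "min (pot Q) (2 * k * D) = pot Q"
        using pot d1 by auto
      have "int D * min (pot Q') (2 * k * D) = D * pot Q - D * (2 * ?d)"
        "int D * min (pot Q) (2 * k * D) = D * pot Q"
        unfolding m by (simp_all add: right_diff_distrib)
      moreover have "int D * 2 \<le> D * (2 * ?d)"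
        using d1 by (intro mult_left_mono) auto
      moreover have combine: "p' + m' < x' \<and> (p' \<le> q \<or> B)"
        if "m' = m - e" "2 * D \<le> e" "p \<le> q" "p + m < x" "x \<le> x' + 2 * D" "p' = p - 2 * d" "1 \<le> d"
        for p p' m m' x x' d e q :: int and B
        using that by linarith
      moreover have "int (D * pair_count Z1 1 Q i j) \<le> int (D * pair_count Z1 1 Q' i j) + 2 * D"
        using c by (simp add: algebra_simps)
      ultimately show ?thesis
        using False by (intro combine[OF _ _ _ inv'(1) _ pot d1]) auto
    qed
  qed
  then show "swap_inv Q'"
    using Q' card inv by (simp add: swap_inv_def)
qed

text \<open>\<open>pot\<close> is a nonnegative integer that every swap lowers, which excludes
  infinite executions; the available swap excludes \<open>Failure\<close>.\<close>

lemma not_can_fail_Swapping: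
  assumes "swap_inv Q"
  shows "\<not> can_fail n k P (Swapping Q)"
  using assms
proof (induction "nat (pot Q)" arbitrary: Q rule: less_induct)
  case less
  show ?case
  proof (cases "\<exists>j\<in>{1..k}. real (\<Sum>(Q j)) \<noteq> target_sum n k")
    case True
    \<comment> \<open>Being stuck while swapping counts as failing, so a step must exist: the finite
      nonempty set of admissible pairs has one of maximal difference.\<close>
    have progress: "\<exists>c. rr_step n k P (Swapping Q) c"
    proof -
      obtain a b where ex: "extremal_sums k Q a b"
        using extremal_exists by blast
      then have ab: "a \<in> {1..k}" "b \<in> {1..k}"
        by (auto simp: extremal_sums_def)
      have Q: "partitions n k Q"
        using less by (simp add: swap_inv_def)
      let ?S = "swap_pairs n k Q a b" and ?h = "\<lambda>(z, w). real z - real w"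
      have "?S \<subseteq> Q a \<times> Q b"
        by (auto simp: swap_pairs_iff)
      then have fin: "finite ?S"
        using partitions_finite[OF Q] ab finite_subset by blast
      have "?S \<noteq> {}"
        using swap_available(2)[OF less.prems True ex] by auto
      then have "Max (?h ` ?S) \<in> ?h ` ?S"
        using fin by (intro Max_in) auto
      then obtain z w where zw: "(z, w) \<in> ?S" "real z - real w = Max (?h ` ?S)"
        by auto
      have "\<forall>(y, y')\<in>?S. real y - real y' \<le> real z - real w"
        unfolding zw(2) using fin by (auto intro!: Max_ge rev_image_eqI)
      then show ?thesis
        using rr_step.swap[OF True ex zw(1)] by blast
    qed
    have "\<not> can_fail n k P c" if "rr_step n k P (Swapping Q) c" for c
      using that
    proof (cases rule: rr_step_SwappingE)
      case (swap a b z w)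
      then have "swap_inv (Q(a := insert w (Q a - {z}), b := insert z (Q b - {w})))"
        "pot (Q(a := insert w (Q a - {z}), b := insert z (Q b - {w}))) < pot Q"
        using swap_preserves[OF less.prems True] by auto
      then show ?thesis
        unfolding swap(5) using pot_nonneg[of Q] pot_pos[OF True] by (intro less.hyps) auto
    next
      case (fail a b)
      then show ?thesis
        using swap_available(2)[OF less.prems True] by auto
    next
      case swapping_done
      then show ?thesis using True by auto
    qed
    then show ?thesis
      using progress can_fail_cases by blast
  next
    case False
    then have "solves n k P Q"
      using less.prems by (auto simp: solves_def swap_inv_def partitions_def)
    then have ret: "\<not> can_fail n k P (Returned Q)"
      by (rule not_can_fail_Returned)
    have "\<not> can_fail n k P c" if "rr_step n k P (Swapping Q) c" for c
      using that by (cases rule: rr_step_SwappingE) (use False less.prems ret swap_available(2) in auto)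
    moreover have "rr_step n k P (Swapping Q) (Returned Q)"
      using False by (intro swapping_done) auto
    ultimately show ?thesis
      using can_fail_cases by blast
  qed
qed

lemma move_preserves:
  assumes inv: "move_inv Q" and ab: "a \<in> {1..k}" "b \<in> {1..k}"
    and cab: "card (Q a) > P ! (a - 1)" "card (Q b) < P ! (b - 1)" and z: "z \<in> Q a"
  shows "move_inv (transfer Q a b z)" and "excess Q = excess (transfer Q a b z) + 1"
proof -
  let ?Q = "transfer Q a b z"
  have Q: "partitions n k Q"
    using inv by (simp add: move_inv_def)
  have a_b: "a \<noteq> b" using cab by auto
  note tr = Q ab a_b z
  have zn: "z \<le> n"
    using Q ab z by (fastforce simp: partitions_def)
  \<comment> \<open>The receiving set is underfull, so its truncated surplus is 0 before and after
    the move.\<close>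
  have "card (?Q j) - P ! (j - 1) + of_bool (j = a) = card (Q j) - P ! (j - 1)" if "j \<in> {1..k}" for j
    using card_transfer[OF tr that] cab a_b by (cases "j = b") (auto split: if_splits)
  then have "excess Q = (\<Sum>j\<in>{1..k}. card (?Q j) - P ! (j - 1) + of_bool (j = a))"
    unfolding excess_def by (intro sum.cong) auto
  then show e: "excess Q = excess ?Q + 1"
    using ab by (simp add: sum.distrib excess_def)
  have "\<bar>dev ?Q j\<bar> \<le> \<bar>dev Q j\<bar> + z * of_bool (j = b) + z * of_bool (j = a)" if "j \<in> {1..k}" for j
    using sum_transfer[OF tr that] a_b unfolding dev_def by (auto simp del: of_nat_sum)
  then have "pot ?Q \<le> (\<Sum>j\<in>{1..k}. \<bar>dev Q j\<bar> + z * of_bool (j = b) + z * of_bool (j = a))"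
    unfolding pot_def by (intro sum_mono) auto
  also have "\<dots> = pot Q + int z * (\<Sum>j\<in>{1..k}. of_bool (j = b)) + int z * (\<Sum>j\<in>{1..k}. of_bool (j = a))"
    by (simp add: sum.distrib pot_def sum_distrib_left)
  finally have pot: "pot ?Q \<le> pot Q + 2 * n"
    using ab zn by simp
  have "pot ?Q + 2 * n * excess ?Q + D * excess ?Q + D * (2 * k * D) < D * pair_count Z1 1 ?Q i j \<and>
        pot ?Q + 2 * n * excess ?Q + D * excess ?Q < D * pair_count Z2 D ?Q i j"
    if ij: "i \<in> {1..k}" "j \<in> {1..k}" "i \<noteq> j" for i j
  proof -
    have inv': "pot Q + 2 * n * excess Q + D * excess Q + D * (2 * k * D) < D * pair_count Z1 1 Q i j"
      "pot Q + 2 * n * excess Q + D * excess Q < D * pair_count Z2 D Q i j"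
      using inv ij by (auto simp: move_inv_def)
    have "int (pair_count Z1 1 Q i j) \<le> int (pair_count Z1 1 ?Q i j + 1)"
      "int (pair_count Z2 D Q i j) \<le> int (pair_count Z2 D ?Q i j + 1)"
      unfolding of_nat_le_iff by (intro pair_count_transfer Z1 Z2)+
    then have c: "int D * pair_count Z1 1 Q i j \<le> int D * (pair_count Z1 1 ?Q i j + 1)"
      "int D * pair_count Z2 D Q i j \<le> int D * (pair_count Z2 D ?Q i j + 1)"
      by (intro mult_left_mono; simp)+
    show ?thesis
      using inv' c pot unfolding e by (auto simp: algebra_simps)
  qed
  then show "move_inv ?Q"
    using partitions_transfer[OF tr] by (simp add: move_inv_def)
qed

text \<open>The loop stops as soon as no set is overfull or no set is underfull. Actual and
  prescribed sizes both sum to \<open>n\<close>, so either case forces equality everywhere.\<close>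

lemma move_inv_done:
  assumes inv: "move_inv Q"
    and no: "\<not> ((\<exists>a\<in>{1..k}. card (Q a) > P ! (a - 1)) \<and> (\<exists>b\<in>{1..k}. card (Q b) < P ! (b - 1)))"
  shows "swap_inv Q"
proof -
  have Q: "partitions n k Q"
    using inv by (simp add: move_inv_def)
  have sums: "(\<Sum>j\<in>{1..k}. card (Q j)) = (\<Sum>j\<in>{1..k}. P ! (j - 1))"
    using partitions_sum_card[OF Q] P_sum by simp
  have card: "card (Q j) = P ! (j - 1)" if "j \<in> {1..k}" for j
  proof (cases "\<exists>a\<in>{1..k}. card (Q a) > P ! (a - 1)")
    case True
    then have "\<And>b. b \<in> {1..k} \<Longrightarrow> P ! (b - 1) \<le> card (Q b)"
      using no by (auto simp: not_less)
    then show ?thesis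
      using sum_mono_inv[OF sums[symmetric]] that by (metis finite_atLeastAtMost)
  next
    case False
    then have "\<And>b. b \<in> {1..k} \<Longrightarrow> card (Q b) \<le> P ! (b - 1)"
      by (auto simp: not_less)
    then show ?thesis
      using sum_mono_inv[OF sums] that by (metis finite_atLeastAtMost)
  qed
  then have "excess Q = 0"
    by (simp add: excess_def)
  moreover have "int D * min (pot Q) (2 * k * D) \<le> int D * int (2 * k * D)"
    by (intro mult_left_mono) auto
  ultimately show ?thesis
    using inv card by (fastforce simp: move_inv_def swap_inv_def)
qed

lemma not_can_fail_Moving:
  assumes "move_inv Q"
  shows "\<not> can_fail n k P (Moving Q)"
  using assms
proof (induction "excess Q" arbitrary: Q rule: less_induct)
  case less
  have "\<exists>c. rr_step n k P (Moving Q) c"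
  proof (cases "(\<exists>a\<in>{1..k}. card (Q a) > P ! (a - 1)) \<and> (\<exists>b\<in>{1..k}. card (Q b) < P ! (b - 1))")
    case True
    then obtain a b where ab: "a \<in> {1..k}" "b \<in> {1..k}" "card (Q a) > P ! (a - 1)" "card (Q b) < P ! (b - 1)"
      by auto
    then obtain z where "z \<in> Q a"
      by fastforce
    then show ?thesis
      using move[OF ab] by blast
  next
    case False
    then show ?thesis
      by (blast intro: moving_done)
  qed
  moreover have "\<not> can_fail n k P c" if "rr_step n k P (Moving Q) c" for c
    using that
  proof (cases rule: rr_step_MovingE)
    case (move a b z)
    then show ?thesis
      using move_preserves[OF less.prems, of a b z] less.hyps[of "transfer Q a b z"] by simp
  next
    case moving_done
    then show ?thesis
      using move_inv_done[OF less.prems] not_can_fail_Swapping by simp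
  qed
  ultimately show ?case
    using can_fail_cases by blast
qed

end

section \<open>Concentration of the rounding\<close>

text \<open>Functions of disjoint groups of coordinates of a product measure are independent. The
  two indices of a group may coincide, so sums over single coordinates are covered too.\<close>

lemma hoeffding_Pi_pmf_pairs:
  fixes p :: "'i \<Rightarrow> 'a::countable pmf" and g :: "'l \<Rightarrow> 'a \<Rightarrow> 'a \<Rightarrow> real" and dflt :: 'a
    and B \<epsilon> :: real
  assumes I: "finite I" and L: "finite L" "L \<noteq> {}"
    and ab: "\<And>l. l \<in> L \<Longrightarrow> a l \<in> I" "\<And>l. l \<in> L \<Longrightarrow> b l \<in> I"
    and disj: "disjoint_family_on (\<lambda>l. {a l, b l}) L"
    and B: "0 < B" and g: "\<And>l x y. l \<in> L \<Longrightarrow> 0 \<le> g l x y" "\<And>l x y. l \<in> L \<Longrightarrow> g l x y \<le> B"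
    and \<epsilon>: "0 \<le> \<epsilon>"
  defines "M \<equiv> Pi_pmf I dflt p"
  defines "E \<equiv> (\<Sum>l\<in>L. measure_pmf.expectation M (\<lambda>X. g l (X (a l)) (X (b l))))"
  shows "measure_pmf.prob M {X. (\<Sum>l\<in>L. g l (X (a l)) (X (b l))) \<le> E - \<epsilon>} \<le> exp (- 2 * \<epsilon>\<^sup>2 / (card L * B\<^sup>2))"
    and "measure_pmf.prob M {X. (\<Sum>l\<in>L. g l (X (a l)) (X (b l))) \<ge> E + \<epsilon>} \<le> exp (- 2 * \<epsilon>\<^sup>2 / (card L * B\<^sup>2))"
proof -
  have "prob_space.indep_vars (measure_pmf M) (\<lambda>l. PiM {a l, b l} (\<lambda>_. count_space UNIV))
      (\<lambda>l X. restrict (\<lambda>i. X i) {a l, b l}) L"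
    unfolding M_def using ab
    by (intro prob_space.indep_vars_restrict[OF measure_pmf.prob_space_axioms indep_vars_Pi_pmf[OF I]] disj) auto
  then have "prob_space.indep_vars (measure_pmf M) (\<lambda>_. borel)
      (\<lambda>l X. g l (restrict (\<lambda>i. X i) {a l, b l} (a l)) (restrict (\<lambda>i. X i) {a l, b l} (b l))) L"
  proof (rule prob_space.indep_vars_compose2[OF measure_pmf.prob_space_axioms])
    fix l assume "l \<in> L"
    have comp: "(\<lambda>h. h i) \<in> measurable (PiM {a l, b l} (\<lambda>_. count_space UNIV)) (count_space (UNIV :: 'a set))"
      if "i \<in> {a l, b l}" for i
      using that by (rule measurable_component_singleton)
    \<comment> \<open>Joint measurability is obtained by fixing the second value, which ranges over
      a countable type.\<close>
    have "(\<lambda>h. g l (h (a l)) y) \<in> borel_measurable (PiM {a l, b l} (\<lambda>_. count_space UNIV))" for y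
      by (rule measurable_compose[OF comp]) simp_all
    then have "(\<lambda>h. (\<lambda>y h. g l (h (a l)) y) (h (b l)) h) \<in> borel_measurable (PiM {a l, b l} (\<lambda>_. count_space UNIV))"
      by (rule measurable_compose_countable) (rule comp, simp)
    then show "(\<lambda>h. g l (h (a l)) (h (b l))) \<in> borel_measurable (PiM {a l, b l} (\<lambda>_. count_space UNIV))"
      by simp
  qed
  then have indep: "prob_space.indep_vars (measure_pmf M) (\<lambda>_. borel) (\<lambda>l X. g l (X (a l)) (X (b l))) L"
    by simp
  interpret H: Hoeffding_ineq "measure_pmf M" L "\<lambda>l X. g l (X (a l)) (X (b l))" "\<lambda>_. 0" "\<lambda>_. B" E
    unfolding E_def by unfold_locales (use L indep g in auto)
  have pos: "0 < (\<Sum>l\<in>L. (B - 0)\<^sup>2)"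
    using L B by (simp add: card_gt_0_iff)
  show "measure_pmf.prob M {X. (\<Sum>l\<in>L. g l (X (a l)) (X (b l))) \<le> E - \<epsilon>} \<le> exp (- 2 * \<epsilon>\<^sup>2 / (card L * B\<^sup>2))"
    using H.Hoeffding_ineq_le[OF \<epsilon> pos] by simp
  show "measure_pmf.prob M {X. (\<Sum>l\<in>L. g l (X (a l)) (X (b l))) \<ge> E + \<epsilon>} \<le> exp (- 2 * \<epsilon>\<^sup>2 / (card L * B\<^sup>2))"
    using H.Hoeffding_ineq_ge[OF \<epsilon> pos] by simp
qed

lemma expectation_component_eq:
  assumes "finite I" "i \<in> I"
  shows "measure_pmf.expectation (Pi_pmf I dflt p) (\<lambda>X. w * of_bool (X i = y)) = (w::real) * pmf (p i) y"
proof -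
  have "measure_pmf.expectation (Pi_pmf I dflt p) (\<lambda>X. w * of_bool (X i = y)) =
      measure_pmf.expectation (map_pmf (\<lambda>X. X i) (Pi_pmf I dflt p)) (\<lambda>u. w * indicator {y} u)"
    by (simp add: indicator_def of_bool_def)
  also have "\<dots> = w * pmf (p i) y"
    using assms by (simp add: Pi_pmf_component measure_pmf_single)
  finally show ?thesis .
qed

text \<open>The event is a box constraining two coordinates, so its probability is a product of
  marginals.\<close>

lemma expectation_two_components_eq:
  assumes I: "finite I" "i \<in> I" "i' \<in> I" "i \<noteq> i'"
  shows "measure_pmf.expectation (Pi_pmf I dflt p) (\<lambda>X. of_bool (X i = y \<and> X i' = y')) =
    (pmf (p i) y * pmf (p i') y' :: real)"
proof -
  let ?B = "\<lambda>l. if l = i then {y} else if l = i' then {y'} else UNIV"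
  have "measure_pmf.expectation (Pi_pmf I dflt p) (\<lambda>X. of_bool (X i = y \<and> X i' = y') :: real) =
      measure_pmf.expectation (Pi_pmf I dflt p) (indicator (Pi I ?B))"
    using assms by (intro Bochner_Integration.integral_cong refl) (auto simp: indicator_def Pi_def)
  also have "\<dots> = (\<Prod>l\<in>I. measure_pmf.prob (p l) (?B l))"
    using I(1) by (simp add: measure_Pi_pmf_Pi)
  also have "\<dots> = measure_pmf.prob (p i) (?B i) * (measure_pmf.prob (p i') (?B i') *
      (\<Prod>l\<in>I - {i} - {i'}. measure_pmf.prob (p l) (?B l)))"
    using assms by (subst prod.remove[of I i]; simp; subst prod.remove[of "I - {i}" i']; simp)
  also have "(\<Prod>l\<in>I - {i} - {i'}. measure_pmf.prob (p l) (?B l)) = 1"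
    by (intro prod.neutral) auto
  finally show ?thesis
    using assms by (simp add: measure_pmf_single)
qed

section \<open>The rounded partition and its tail bounds\<close>

lemma rounded_sets_mem: "z \<in> rounded_sets n X j \<longleftrightarrow> z \<in> {1..n} \<and> X (Suc n - z) = j"
proof
  assume "z \<in> rounded_sets n X j"
  then show "z \<in> {1..n} \<and> X (Suc n - z) = j"
    by (auto simp: rounded_sets_def Suc_diff_le)
next
  assume "z \<in> {1..n} \<and> X (Suc n - z) = j"
  then show "z \<in> rounded_sets n X j"
    unfolding rounded_sets_def by (intro CollectI exI[of _ "Suc n - z"]) auto
qed

lemma sum_rounded_sets:
  fixes h :: "nat \<Rightarrow> 'b::semiring_1"
  shows "(\<Sum>z\<in>rounded_sets n X j. h z) = (\<Sum>i\<in>{1..n}. h (n - i + 1) * of_bool (X i = j))"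
proof -
  have "rounded_sets n X j = (\<lambda>i. n - i + 1) ` {i \<in> {1..n}. X i = j}"
    by (auto simp: rounded_sets_def)
  moreover have "inj_on (\<lambda>i. n - i + 1) {i \<in> {1..n}. X i = j}"
    by (auto simp: inj_on_def)
  ultimately have "(\<Sum>z\<in>rounded_sets n X j. h z) = (\<Sum>i\<in>{i \<in> {1..n}. X i = j}. h (n - i + 1))"
    by (simp add: sum.reindex o_def)
  also have "\<dots> = (\<Sum>i\<in>{1..n}. h (n - i + 1) * of_bool (X i = j))"
    by (subst sum.inter_filter, simp, intro sum.cong refl, simp)
  finally show ?thesis .
qed

text \<open>Row \<open>i\<close>, counted from 0, belongs to the element \<open>n - i\<close>, so
  \<open>mixed\<close> speaks of the elements from 1 to \<open>M\<close> when \<open>M\<close> is at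
  most \<open>n\<close>.\<close>

locale rounding =
  fixes n k :: nat and P :: "nat list" and x :: "real list list" and M :: nat and \<eta> :: real
  assumes fs: "fractional_solution (instance_sources n) (instance_targets n k P) x"
    and n_pos: "1 \<le> n" and \<eta>: "0 < \<eta>"
    and mixed: "\<And>i j. n - M \<le> i \<Longrightarrow> i < n \<Longrightarrow> j < k \<Longrightarrow> \<eta> \<le> x ! i ! j"
begin

definition row_pmf :: "nat \<Rightarrow> nat pmf" where
  "row_pmf i = embed_pmf (\<lambda>j. if j \<in> {1..k} then x ! (i - 1) ! (j - 1) else 0)"

lemma rounding_pmf_eq: "rounding_pmf n k x = Pi_pmf {1..n} 0 row_pmf"
  by (simp add: rounding_pmf_def row_pmf_def[abs_def])

lemma sum_shift: "(\<Sum>j\<in>{1..m}. h (j - 1)) = (\<Sum>j<m. h j)" for h :: "nat \<Rightarrow> real"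
  by (rule sum.reindex_bij_witness[of _ Suc "\<lambda>j. j - 1"]) auto

lemma x_facts:
  shows x_nonneg: "\<And>i j. i < n \<Longrightarrow> j < k \<Longrightarrow> 0 \<le> x ! i ! j"
    and x_row: "\<And>i. i < n \<Longrightarrow> (\<Sum>j<k. x ! i ! j) = 1"
    and x_card: "\<And>j. j < k \<Longrightarrow> (\<Sum>i<n. x ! i ! j) = P ! j"
    and x_sum: "\<And>j. j < k \<Longrightarrow> (\<Sum>i<n. real (n - i) * x ! i ! j) = target_sum n k"
proof -
  have len: "length (instance_sources n) = n" "length (instance_targets n k P) = k"
    by (simp_all add: instance_sources_def instance_targets_def del: upt_Suc)
  have nth: "i < n \<Longrightarrow> instance_sources n ! i = (real (n - i), 1)"
    "j < k \<Longrightarrow> instance_targets n k P ! j = (target_sum n k, real (P ! j))" for i j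
    by (simp_all add: instance_sources_def instance_targets_def Suc_diff_Suc del: upt_Suc)
  show "\<And>i j. i < n \<Longrightarrow> j < k \<Longrightarrow> 0 \<le> x ! i ! j" "\<And>i. i < n \<Longrightarrow> (\<Sum>j<k. x ! i ! j) = 1"
    "\<And>j. j < k \<Longrightarrow> (\<Sum>i<n. x ! i ! j) = P ! j"
    "\<And>j. j < k \<Longrightarrow> (\<Sum>i<n. real (n - i) * x ! i ! j) = target_sum n k"
    using fs by (simp_all add: fractional_solution_def len nth)
qed

text \<open>\<open>embed_pmf\<close> is known to have the given masses only when they are
  nonnegative and sum to 1, which is what the row conditions of a fractional solution
  supply.\<close>

lemma pmf_row:
  assumes i: "i \<in> {1..n}"
  shows "pmf (row_pmf i) j = (if j \<in> {1..k} then x ! (i - 1) ! (j - 1) else 0)"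
  unfolding row_pmf_def
proof (rule pmf_embed_pmf)
  let ?f = "\<lambda>j. if j \<in> {1..k} then x ! (i - 1) ! (j - 1) else 0"
  show nonneg: "0 \<le> ?f j" for j
    using i x_nonneg[of "i - 1" "j - 1"] by auto
  have "(\<integral>\<^sup>+ j. ennreal (?f j) \<partial>count_space UNIV) = (\<Sum>j\<in>{1..k}. ennreal (?f j))"
    by (rule nn_integral_count_space') auto
  also have "\<dots> = ennreal (\<Sum>j\<in>{1..k}. ?f j)"
    using nonneg by (rule sum_ennreal)
  also have "(\<Sum>j\<in>{1..k}. ?f j) = (\<Sum>j\<in>{1..k}. x ! (i - 1) ! (j - 1))"
    by (intro sum.cong) auto
  also have "\<dots> = 1"
    unfolding sum_shift[of "\<lambda>j. x ! (i - 1) ! j" k] by (rule x_row) (use i in auto)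
  finally show "(\<integral>\<^sup>+ j. ennreal (?f j) \<partial>count_space UNIV) = 1"
    by simp
qed

lemma support_partitions:
  assumes X: "X \<in> set_pmf (rounding_pmf n k x)"
  shows "partitions n k (rounded_sets n X)"
proof -
  have "X i \<in> {1..k}" if "i \<in> {1..n}" for i
  proof -
    have "X i \<in> set_pmf (row_pmf i)"
      using X that set_Pi_pmf_subset'[of "{1..n}" 0 row_pmf] by (auto simp: rounding_pmf_eq PiE_dflt_def)
    then show ?thesis
      using pmf_row[OF that, of "X i"] by (auto simp: set_pmf_iff split: if_splits)
  qed
  moreover have "Suc n - z \<in> {1..n}" if "z \<in> {1..n}" for z
    using that by auto
  ultimately have "\<And>z. z \<in> {1..n} \<Longrightarrow> X (Suc n - z) \<in> {1..k}"
    by blast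
  then show ?thesis
    by (auto simp: partitions_def disjoint_family_on_def rounded_sets_mem)
qed

lemma singles_prob:
  fixes h :: "nat \<Rightarrow> real" and B E \<epsilon> :: real
  assumes j: "j \<in> {1..k}" and \<epsilon>: "0 \<le> \<epsilon>" and B: "0 < B"
    and h: "\<And>i. i \<in> {1..n} \<Longrightarrow> 0 \<le> h i" "\<And>i. i \<in> {1..n} \<Longrightarrow> h i \<le> B"
    and E: "(\<Sum>i\<in>{1..n}. h i * x ! (i - 1) ! (j - 1)) = E"
  shows "measure_pmf.prob (rounding_pmf n k x) {X. \<bar>(\<Sum>i\<in>{1..n}. h i * of_bool (X i = j)) - E\<bar> \<ge> \<epsilon>}
    \<le> 2 * exp (- 2 * \<epsilon>\<^sup>2 / (n * B\<^sup>2))"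
proof -
  let ?M = "rounding_pmf n k x" and ?S = "\<lambda>X. \<Sum>i\<in>{1..n}. h i * of_bool (X i = j)"
  have "(\<Sum>i\<in>{1..n}. measure_pmf.expectation ?M (\<lambda>X. h i * of_bool (X i = j))) = E"
    unfolding E[symmetric] rounding_pmf_eq
    using j by (intro sum.cong refl, subst expectation_component_eq, simp_all only: pmf_row finite_atLeastAtMost if_True)
  moreover have "finite {1..n}" "{1..n} \<noteq> {}" "disjoint_family_on (\<lambda>l. {l, l}) {1..n}"
    using n_pos by (auto simp: disjoint_family_on_def)
  ultimately have
    "measure_pmf.prob ?M {X. ?S X \<le> E - \<epsilon>} \<le> exp (- 2 * \<epsilon>\<^sup>2 / (card {1..n} * B\<^sup>2))"
    "measure_pmf.prob ?M {X. ?S X \<ge> E + \<epsilon>} \<le> exp (- 2 * \<epsilon>\<^sup>2 / (card {1..n} * B\<^sup>2))"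
    unfolding rounding_pmf_eq
    using hoeffding_Pi_pmf_pairs[of "{1..n}" "{1..n}" "\<lambda>l. l" "\<lambda>l. l" B
        "\<lambda>i u _. h i * of_bool (u = j)" \<epsilon> 0 row_pmf] h B \<epsilon>
    by (auto simp: of_bool_def)
  moreover have "{X. \<bar>?S X - E\<bar> \<ge> \<epsilon>} = {X. ?S X \<le> E - \<epsilon>} \<union> {X. ?S X \<ge> E + \<epsilon>}"
    by auto
  moreover have "measure_pmf.prob ?M ({X. ?S X \<le> E - \<epsilon>} \<union> {X. ?S X \<ge> E + \<epsilon>}) \<le>
      measure_pmf.prob ?M {X. ?S X \<le> E - \<epsilon>} + measure_pmf.prob ?M {X. ?S X \<ge> E + \<epsilon>}"
    by (rule measure_Un_le) auto
  ultimately show ?thesis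
    by simp
qed

lemma card_prob:
  fixes \<epsilon> :: real
  assumes j: "j \<in> {1..k}" and \<epsilon>: "0 \<le> \<epsilon>"
  shows "measure_pmf.prob (rounding_pmf n k x) {X. \<bar>real (card (rounded_sets n X j)) - P ! (j - 1)\<bar> \<ge> \<epsilon> * n}
    \<le> 2 * exp (- 2 * \<epsilon>\<^sup>2 * n)"
proof -
  have jk: "j - 1 < k" using j by auto
  have "(\<Sum>i\<in>{1..n}. 1 * x ! (i - 1) ! (j - 1)) = P ! (j - 1)"
    using x_card[OF jk] sum_shift[of "\<lambda>i. x ! i ! (j - 1)" n] by simp
  from singles_prob[OF j _ _ _ _ this, of "\<epsilon> * n" 1]
  have "measure_pmf.prob (rounding_pmf n k x)
      {X. \<bar>(\<Sum>i\<in>{1..n}. of_bool (X i = j)) - real (P ! (j - 1))\<bar> \<ge> \<epsilon> * n} \<le> 2 * exp (- 2 * (\<epsilon> * n)\<^sup>2 / n)"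
    using \<epsilon> by simp
  moreover have "real (card (rounded_sets n X j)) = (\<Sum>i\<in>{1..n}. of_bool (X i = j))" for X
    using sum_rounded_sets[of "\<lambda>_. 1 :: real" n X j] by simp
  moreover have "- 2 * (\<epsilon> * n)\<^sup>2 / n = - 2 * \<epsilon>\<^sup>2 * n"
    using n_pos by (simp add: power2_eq_square)
  ultimately show ?thesis
    by simp
qed

text \<open>The weights are at most n and the deviation is measured in n^2, so Hoeffding's exponent
  has the ratio n^4 / (n * n^2) and stays linear in n.\<close>

lemma sum_prob:
  fixes \<epsilon> :: real
  assumes j: "j \<in> {1..k}" and \<epsilon>: "0 \<le> \<epsilon>"
  shows "measure_pmf.prob (rounding_pmf n k x) {X. \<bar>real (\<Sum>(rounded_sets n X j)) - target_sum n k\<bar> \<ge> \<epsilon> * n\<^sup>2}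
    \<le> 2 * exp (- 2 * \<epsilon>\<^sup>2 * n)"
proof -
  have jk: "j - 1 < k" using j by auto
  have "(\<Sum>i\<in>{1..n}. real (n - i + 1) * x ! (i - 1) ! (j - 1)) = (\<Sum>i\<in>{1..n}. real (n - (i - 1)) * x ! (i - 1) ! (j - 1))"
    by (intro sum.cong refl) (auto simp: Suc_diff_le)
  also have "\<dots> = target_sum n k"
    unfolding sum_shift[of "\<lambda>i. real (n - i) * x ! i ! (j - 1)" n] by (rule x_sum[OF jk])
  finally have "(\<Sum>i\<in>{1..n}. real (n - i + 1) * x ! (i - 1) ! (j - 1)) = target_sum n k" .
  from singles_prob[OF j _ _ _ _ this, of "\<epsilon> * n\<^sup>2" n]
  have "measure_pmf.prob (rounding_pmf n k x)
      {X. \<bar>(\<Sum>i\<in>{1..n}. real (n - i + 1) * of_bool (X i = j)) - target_sum n k\<bar> \<ge> \<epsilon> * n\<^sup>2}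
      \<le> 2 * exp (- 2 * (\<epsilon> * n\<^sup>2)\<^sup>2 / (n * n\<^sup>2))"
    using \<epsilon> n_pos by auto
  moreover have "real (\<Sum>(rounded_sets n X j)) = (\<Sum>i\<in>{1..n}. real (n - i + 1) * of_bool (X i = j))" for X
    using sum_rounded_sets[of real n X j] by simp
  moreover have "- 2 * (\<epsilon> * n\<^sup>2)\<^sup>2 / (n * n\<^sup>2) = - 2 * \<epsilon>\<^sup>2 * n"
    using n_pos by (simp add: power2_eq_square)
  ultimately show ?thesis
    by (simp del: of_nat_sum of_nat_add of_nat_Suc)
qed

text \<open>A single pair is split as required with probability at least \<eta>^2, since its two
  elements are distinct and rounded independently. The event asks for at most half of this lower
  bound on the mean.\<close>

lemma pair_prob:
  assumes ab: "a \<in> {1..k}" "b \<in> {1..k}"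
    and Z: "finite Z" "Z \<noteq> {}" "\<And>z. z \<in> Z \<Longrightarrow> 1 \<le> z \<and> z + d \<le> M" "disjoint_family_on (\<lambda>z. {z, z + d}) Z"
    and d: "1 \<le> d" and M: "M \<le> n"
  shows "measure_pmf.prob (rounding_pmf n k x) {X. real (pair_count Z d (rounded_sets n X) a b) \<le> \<eta>\<^sup>2 / 2 * card Z}
    \<le> exp (- (\<eta> ^ 4 / 2) * card Z)"
proof -
  let ?M = "rounding_pmf n k x"
  let ?S = "\<lambda>X. \<Sum>z\<in>Z. of_bool (X (Suc n - z) = b \<and> X (Suc n - (z + d)) = a) :: real"
  define E where "E = (\<Sum>z\<in>Z. measure_pmf.expectation ?M (\<lambda>X. of_bool (X (Suc n - z) = b \<and> X (Suc n - (z + d)) = a) :: real))"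
  have zn: "1 \<le> z" "z + d \<le> n" if "z \<in> Z" for z
    using Z(3)[OF that] M by auto
  have "\<eta>\<^sup>2 \<le> measure_pmf.expectation ?M (\<lambda>X. of_bool (X (Suc n - z) = b \<and> X (Suc n - (z + d)) = a) :: real)"
    if z: "z \<in> Z" for z
  proof -
    have "\<eta> * \<eta> \<le> x ! (n - z) ! (b - 1) * x ! (n - (z + d)) ! (a - 1)"
    proof (rule mult_mono)
      show b: "\<eta> \<le> x ! (n - z) ! (b - 1)" and "\<eta> \<le> x ! (n - (z + d)) ! (a - 1)"
        using Z(3)[OF z] zn[OF z] ab d by (auto intro!: mixed)
      show "0 \<le> x ! (n - z) ! (b - 1)" "0 \<le> \<eta>"
        using b \<eta> by linarith+
    qed
    also have "\<dots> = pmf (row_pmf (Suc n - z)) b * pmf (row_pmf (Suc n - (z + d))) a"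
      using zn[OF z] ab by (subst (1 2) pmf_row) auto
    also have "\<dots> = measure_pmf.expectation ?M (\<lambda>X. of_bool (X (Suc n - z) = b \<and> X (Suc n - (z + d)) = a) :: real)"
      unfolding rounding_pmf_eq using zn[OF z] d by (subst expectation_two_components_eq) auto
    finally show ?thesis
      by (simp add: power2_eq_square)
  qed
  then have E: "\<eta>\<^sup>2 * card Z \<le> E"
    unfolding E_def by (subst mult.commute, intro sum_bounded_below) auto
  have disj: "disjoint_family_on (\<lambda>z. {Suc n - z, Suc n - (z + d)}) Z"
    unfolding disjoint_family_on_def
  proof (intro ballI impI)
    fix z z' assume z: "z \<in> Z" "z' \<in> Z" "z \<noteq> z'"
    then have "{z, z + d} \<inter> {z', z' + d} = {}"
      using Z(4) by (auto simp: disjoint_family_on_def)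
    moreover have "z + d \<le> n" "z' + d \<le> n"
      using z zn by auto
    moreover have "inj_on (\<lambda>y. Suc n - y) {..n}"
      by (auto simp: inj_on_def)
    ultimately have "(\<lambda>y. Suc n - y) ` {z, z + d} \<inter> (\<lambda>y. Suc n - y) ` {z', z' + d} = {}"
      by (subst inj_on_image_Int[of _ "{..n}", symmetric]) auto
    then show "{Suc n - z, Suc n - (z + d)} \<inter> {Suc n - z', Suc n - (z' + d)} = {}"
      by simp
  qed
  define \<epsilon> where "\<epsilon> = \<eta>\<^sup>2 / 2 * card Z"
  have "0 \<le> \<epsilon>"
    by (simp add: \<epsilon>_def)
  then have tail: "measure_pmf.prob ?M {X. ?S X \<le> E - \<epsilon>} \<le> exp (- 2 * \<epsilon>\<^sup>2 / (real (card Z) * 1\<^sup>2))"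
    unfolding E_def rounding_pmf_eq
  proof (intro hoeffding_Pi_pmf_pairs(1)[where g = "\<lambda>z u v. of_bool (u = b \<and> v = a)" and B = 1
        and a = "\<lambda>z. Suc n - z" and b = "\<lambda>z. Suc n - (z + d)"] disj Z)
    fix z assume "z \<in> Z"
    then show "Suc n - z \<in> {1..n}" "Suc n - (z + d) \<in> {1..n}"
      using zn[of z] by auto
  qed simp_all
  have exponent: "- 2 * \<epsilon>\<^sup>2 / (real (card Z) * 1\<^sup>2) = - (\<eta> ^ 4 / 2) * card Z"
    using Z by (simp add: \<epsilon>_def power2_eq_square power4_eq_xxxx card_gt_0_iff)
  have "real (pair_count Z d (rounded_sets n X) a b) = ?S X" for X
  proof -
    have "{z \<in> Z. z \<in> rounded_sets n X b \<and> z + d \<in> rounded_sets n X a} =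
        {z \<in> Z. X (Suc n - z) = b \<and> X (Suc n - (z + d)) = a}"
      using zn by (fastforce simp: rounded_sets_mem)
    then show ?thesis
      using Z(1) by (simp add: pair_count_def of_bool_def sum.If_cases Int_def)
  qed
  then have "{X. real (pair_count Z d (rounded_sets n X) a b) \<le> \<eta>\<^sup>2 / 2 * card Z} \<subseteq> {X. ?S X \<le> E - \<epsilon>}"
    using E by (auto simp: \<epsilon>_def)
  then have "measure_pmf.prob ?M {X. real (pair_count Z d (rounded_sets n X) a b) \<le> \<eta>\<^sup>2 / 2 * card Z} \<le>
      measure_pmf.prob ?M {X. ?S X \<le> E - \<epsilon>}"
    by (intro measure_pmf.finite_measure_mono) auto
  with tail show ?thesis
    unfolding exponent by linarith
qed

end

section \<open>Failure probability\<close>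

text \<open>With \<open>pot\<close> at most k \<epsilon> n^2, \<open>excess\<close> at most k
  \<epsilon> n and D at most n, the cost of moves and large swaps is at most 4 k \<epsilon> n^2;
  \<epsilon> is tuned so that D times the guaranteed number of D-pairs covers this. Likewise
  \<kappa> is tuned so that the final unit swaps use at most half of the guaranteed unit pairs; the
  other half covers the remaining cost because \<kappa> is at most \<gamma> / 4.\<close>

lemma (in repair) move_invI:
  fixes \<epsilon> \<kappa> \<gamma> \<eta> :: real
  assumes Q: "partitions n k Q"
    and card: "\<And>j. j \<in> {1..k} \<Longrightarrow> \<bar>real (card (Q j)) - P ! (j - 1)\<bar> \<le> \<epsilon> * n"
    and sum: "\<And>j. j \<in> {1..k} \<Longrightarrow> \<bar>real (\<Sum>(Q j)) - target_sum n k\<bar> \<le> \<epsilon> * n\<^sup>2"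
    and c1: "\<And>a b. a \<in> {1..k} \<Longrightarrow> b \<in> {1..k} \<Longrightarrow> a \<noteq> b \<Longrightarrow> \<eta>\<^sup>2 * \<gamma> / 8 * n < pair_count Z1 1 Q a b"
    and c2: "\<And>a b. a \<in> {1..k} \<Longrightarrow> b \<in> {1..k} \<Longrightarrow> a \<noteq> b \<Longrightarrow> \<eta>\<^sup>2 * \<kappa> / 4 * n < pair_count Z2 D Q a b"
    and D: "\<kappa> * n / 2 \<le> D" "D \<le> \<kappa> * n"
    and \<kappa>: "0 < \<kappa>" "\<kappa> \<le> 1" "2 * k * \<kappa> = \<eta>\<^sup>2 * \<gamma> / 16" "\<kappa> \<le> \<gamma> / 4"
    and \<epsilon>: "0 \<le> \<epsilon>" "8 * k * \<epsilon> = \<eta>\<^sup>2 * \<kappa> / 4 * \<kappa>"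
  shows "move_inv Q"
proof -
  have pot: "real_of_int (pot Q) \<le> k * \<epsilon> * n\<^sup>2"
  proof -
    have "real_of_int (pot Q) = (\<Sum>j\<in>{1..k}. \<bar>real (\<Sum>(Q j)) - target_sum n k\<bar>)"
      by (simp add: pot_def dev_def target)
    also have "\<dots> \<le> (\<Sum>j\<in>{1..k}. \<epsilon> * n\<^sup>2)"
      by (intro sum_mono sum)
    finally show ?thesis by (simp add: mult.assoc)
  qed
  have ex: "real (excess Q) \<le> k * \<epsilon> * n"
  proof -
    have "real (excess Q) = (\<Sum>j\<in>{1..k}. real (card (Q j) - P ! (j - 1)))"
      by (simp add: excess_def)
    also have "\<dots> \<le> (\<Sum>j\<in>{1..k}. \<epsilon> * n)"
    proof (rule sum_mono)
      fix j assume "j \<in> {1..k}"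
      then have "\<bar>real (card (Q j)) - P ! (j - 1)\<bar> \<le> \<epsilon> * n"
        by (rule card)
      then show "real (card (Q j) - P ! (j - 1)) \<le> \<epsilon> * n"
        using \<epsilon>(1) by (cases "P ! (j - 1) \<le> card (Q j)") (auto simp: of_nat_diff)
    qed
    finally show ?thesis by (simp add: mult.assoc)
  qed
  have Dn: "real D \<le> n"
  proof -
    have "\<kappa> * n \<le> 1 * real n"
      using \<kappa>(2) by (rule mult_right_mono) simp
    with D(2) show ?thesis by linarith
  qed
  let ?L = "real_of_int (pot Q) + 2 * n * excess Q + D * excess Q"
  have "?L \<le> k * \<epsilon> * n\<^sup>2 + 2 * n * (k * \<epsilon> * n) + n * (k * \<epsilon> * n)"
    using pot by (rule add_mono[OF add_mono])
      (use mult_left_mono[OF ex, of "2 * n"] mult_mono[OF Dn ex] in auto)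
  also have "\<dots> = 8 * k * \<epsilon> * (n / 2) * n"
    by (simp add: power2_eq_square algebra_simps)
  also have "\<dots> = \<eta>\<^sup>2 * \<kappa> / 4 * (\<kappa> * n / 2) * n"
    unfolding \<epsilon>(2) by simp
  also have "\<dots> \<le> \<eta>\<^sup>2 * \<kappa> / 4 * D * n"
    using D(1) \<kappa>(1) by (intro mult_right_mono mult_left_mono) auto
  finally have L: "?L \<le> D * (\<eta>\<^sup>2 * \<kappa> / 4 * n)"
    by (simp add: mult_ac)
  have "real D * (2 * real k * D) \<le> D * (2 * real k * (\<kappa> * n))"
    using D(2) by (intro mult_left_mono) auto
  also have "\<dots> = D * (2 * k * \<kappa> * n)"
    by simp
  also have "\<dots> = D * (\<eta>\<^sup>2 * \<gamma> / 16 * n)"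
    unfolding \<kappa>(3) ..
  finally have DD: "real D * (2 * real k * D) \<le> D * (\<eta>\<^sup>2 * \<gamma> / 16 * n)" .
  have "\<eta>\<^sup>2 * \<kappa> / 4 * n \<le> \<eta>\<^sup>2 * \<gamma> / 16 * n"
    using mult_left_mono[OF \<kappa>(4), of "\<eta>\<^sup>2 / 4"] by (intro mult_right_mono) (auto simp: mult_ac)
  then have le: "D * (\<eta>\<^sup>2 * \<kappa> / 4 * n) \<le> D * (\<eta>\<^sup>2 * \<gamma> / 16 * n)"
    by (intro mult_left_mono) auto
  have "pot Q + 2 * n * excess Q + D * excess Q + D * (2 * k * D) < D * pair_count Z1 1 Q a b \<and>
        pot Q + 2 * n * excess Q + D * excess Q < D * pair_count Z2 D Q a b"
    if ab: "a \<in> {1..k}" "b \<in> {1..k}" "a \<noteq> b" for a b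
  proof -
    have "D * (\<eta>\<^sup>2 * \<gamma> / 8 * n) < D * real (pair_count Z1 1 Q a b)"
      "D * (\<eta>\<^sup>2 * \<kappa> / 4 * n) < D * real (pair_count Z2 D Q a b)"
      using c1[OF ab] c2[OF ab] D_pos by (intro mult_strict_left_mono; simp)+
    moreover have "D * (\<eta>\<^sup>2 * \<gamma> / 8 * n) = D * (\<eta>\<^sup>2 * \<gamma> / 16 * n) + D * (\<eta>\<^sup>2 * \<gamma> / 16 * n)"
      by simp
    ultimately have
      "?L + real D * (2 * real k * D) < D * real (pair_count Z1 1 Q a b)" "?L < D * real (pair_count Z2 D Q a b)"
      using L DD le by linarith+
    then have "real_of_int (pot Q + 2 * n * excess Q + D * excess Q + D * (2 * k * D)) < real_of_int (D * pair_count Z1 1 Q a b)"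
      "real_of_int (pot Q + 2 * n * excess Q + D * excess Q) < real_of_int (D * pair_count Z2 D Q a b)"
      by simp_all
    then show ?thesis
      unfolding of_int_less_iff by simp
  qed
  then show ?thesis
    using Q by (simp add: move_inv_def)
qed

lemma (in rounding) failure_prob_le:
  fixes \<gamma> \<kappa> \<epsilon> :: real and t :: nat
  assumes target: "target_sum n k = real t" and k_pos: "1 \<le> k"
    and P_sum: "(\<Sum>j\<in>{1..k}. P ! (j - 1)) = n"
    and M: "M = \<gamma> * n" and \<gamma>: "0 < \<gamma>" "\<gamma> \<le> 1" and \<eta>1: "\<eta> \<le> 1"
  defines "\<kappa> \<equiv> \<eta>\<^sup>2 * \<gamma> / (32 * k)"
  defines "\<epsilon> \<equiv> \<eta>\<^sup>2 * \<kappa>\<^sup>2 / (32 * k)"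
  assumes n_large: "1 \<le> \<kappa> * n"
  shows "measure_pmf.prob (rounding_pmf n k x) {X. can_fail n k P (Moving (rounded_sets n X))}
    \<le> (4 * k + 2 * k\<^sup>2) * exp (- min (2 * \<epsilon>\<^sup>2) (\<eta> ^ 4 * \<kappa> / 4) * n)"
proof -
  define D where "D = nat \<lfloor>\<kappa> * n\<rfloor>"
  \<comment> \<open>The odd numbers give the pairs {1, 2}, {3, 4}, and so on inside {1..M}. For
    \<open>Z2\<close> the two blocks {1..D} and {D + 1..2 * D} are matched, which fits since 2 * D
    is at most M.\<close>
  define Z1 where "Z1 = (\<lambda>i. 2 * i + 1) ` {..<M div 2}"
  define Z2 where "Z2 = {1..D}"
  have k1: "1 \<le> real k"
    using k_pos by simp
  have \<kappa>: "0 < \<kappa>" "\<kappa> \<le> \<gamma> / 32"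
  proof -
    show "0 < \<kappa>"
      using \<eta> \<gamma> k1 by (simp add: \<kappa>_def)
    have "\<eta>\<^sup>2 * \<gamma> \<le> 1 * \<gamma>"
      using \<eta> \<eta>1 \<gamma> by (intro mult_right_mono) (auto simp: power_le_one)
    also have "\<dots> \<le> \<gamma> * k"
      using \<gamma> k1 by simp
    finally show "\<kappa> \<le> \<gamma> / 32"
      using k1 by (simp add: \<kappa>_def field_simps)
  qed
  have D: "real D \<le> \<kappa> * n" "\<kappa> * n / 2 \<le> D" "1 \<le> D"
  proof -
    have "real D = of_int \<lfloor>\<kappa> * n\<rfloor>"
      using n_large by (simp add: D_def)
    moreover have "1 \<le> \<lfloor>\<kappa> * n\<rfloor>"
      using n_large by (simp add: le_floor_iff)
    ultimately show "real D \<le> \<kappa> * n" "\<kappa> * n / 2 \<le> D" "1 \<le> D"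
      using n_large by linarith+
  qed
  have Mn: "M \<le> n"
  proof -
    have "\<gamma> * n \<le> 1 * real n"
      using \<gamma>(2) by (rule mult_right_mono) simp
    then show ?thesis
      using M by simp
  qed
  have "32 * \<kappa> * n \<le> \<gamma> * n"
    using \<kappa> by (intro mult_right_mono) auto
  then have MD: "32 * (\<kappa> * n) \<le> M"
    by (simp add: M)
  have cardZ1: "\<gamma> * n / 4 \<le> card Z1"
  proof -
    have "card Z1 = M div 2"
      unfolding Z1_def by (subst card_image) (auto simp: inj_on_def)
    moreover have "real M / 4 \<le> real (M div 2)"
      using MD n_large by linarith
    ultimately show ?thesis
      by (simp add: M)
  qed
  have cardZ2: "card Z2 = D"
    by (simp add: Z2_def)
  have Z1_pairs: "finite Z1" "Z1 \<noteq> {}" "disjoint_family_on (\<lambda>z. {z, z + 1}) Z1" "\<And>z. z \<in> Z1 \<Longrightarrow> 1 \<le> z \<and> z + 1 \<le> M"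
  proof -
    show "Z1 \<noteq> {}"
      using cardZ1 MD n_large M by auto
    show "disjoint_family_on (\<lambda>z. {z, z + 1}) Z1"
      unfolding Z1_def disjoint_family_on_def by auto
    show "\<And>z. z \<in> Z1 \<Longrightarrow> 1 \<le> z \<and> z + 1 \<le> M"
      unfolding Z1_def by auto
  qed (simp add: Z1_def)
  have Z2_pairs: "finite Z2" "Z2 \<noteq> {}" "disjoint_family_on (\<lambda>z. {z, z + D}) Z2" "\<And>z. z \<in> Z2 \<Longrightarrow> 1 \<le> z \<and> z + D \<le> M"
  proof -
    have "2 * real D \<le> M"
      using D MD n_large by linarith
    then have "2 * D \<le> M" by simp
    then show "\<And>z. z \<in> Z2 \<Longrightarrow> 1 \<le> z \<and> z + D \<le> M"
      unfolding Z2_def by auto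
  qed (use D in \<open>auto simp: Z2_def disjoint_family_on_def\<close>)
  interpret repair n k P t D Z1 Z2
    by unfold_locales (use target k_pos P_sum D Z1_pairs Z2_pairs in auto)
  have \<epsilon>: "0 \<le> \<epsilon>" "8 * k * \<epsilon> = \<eta>\<^sup>2 * \<kappa> / 4 * \<kappa>"
    using k1 by (simp_all add: \<epsilon>_def power2_eq_square)
  have \<kappa>': "\<kappa> \<le> 1" "2 * k * \<kappa> = \<eta>\<^sup>2 * \<gamma> / 16" "\<kappa> \<le> \<gamma> / 4"
  proof -
    show "2 * k * \<kappa> = \<eta>\<^sup>2 * \<gamma> / 16"
      using k1 by (simp add: \<kappa>_def)
  qed (use \<kappa> \<gamma> in linarith)+
  let ?M = "rounding_pmf n k x" and ?Q = "\<lambda>X. rounded_sets n X"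
  define A1 where "A1 j = {X. \<bar>real (card (?Q X j)) - P ! (j - 1)\<bar> \<ge> \<epsilon> * n}" for j
  define A2 where "A2 j = {X. \<bar>real (\<Sum>(?Q X j)) - target_sum n k\<bar> \<ge> \<epsilon> * n\<^sup>2}" for j
  define B1 where "B1 = (\<lambda>(a, b). {X. real (pair_count Z1 1 (?Q X) a b) \<le> \<eta>\<^sup>2 / 2 * card Z1})"
  define B2 where "B2 = (\<lambda>(a, b). {X. real (pair_count Z2 D (?Q X) a b) \<le> \<eta>\<^sup>2 / 2 * card Z2})"
  let ?J = "{1..k}"
  have good: "\<not> can_fail n k P (Moving (?Q X))"
    if X: "X \<in> set_pmf ?M" "X \<notin> (\<Union>j\<in>?J. A1 j) \<union> (\<Union>j\<in>?J. A2 j) \<union> (\<Union>p\<in>?J \<times> ?J. B1 p) \<union> (\<Union>p\<in>?J \<times> ?J. B2 p)" for X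
  proof (rule not_can_fail_Moving, rule move_invI[where \<epsilon> = \<epsilon> and \<kappa> = \<kappa> and \<gamma> = \<gamma> and \<eta> = \<eta>])
    show "partitions n k (?Q X)"
      using X(1) by (rule support_partitions)
    show "\<bar>real (card (?Q X j)) - P ! (j - 1)\<bar> \<le> \<epsilon> * n" if "j \<in> ?J" for j
      using X(2) that by (auto simp: A1_def not_le intro: less_imp_le)
    show "\<bar>real (\<Sum>(?Q X j)) - target_sum n k\<bar> \<le> \<epsilon> * n\<^sup>2" if "j \<in> ?J" for j
      using X(2) that by (auto simp: A2_def not_le intro: less_imp_le simp del: of_nat_sum)
    fix a b assume ab: "a \<in> ?J" "b \<in> ?J" "a \<noteq> b"
    have "\<eta>\<^sup>2 / 2 * card Z1 < pair_count Z1 1 (?Q X) a b"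
      using X(2) ab by (force simp: B1_def not_le)
    moreover have "\<eta>\<^sup>2 / 2 * (\<gamma> * n / 4) \<le> \<eta>\<^sup>2 / 2 * card Z1"
      using cardZ1 by (intro mult_left_mono) auto
    moreover have "\<eta>\<^sup>2 * \<gamma> / 8 * n = \<eta>\<^sup>2 / 2 * (\<gamma> * n / 4)"
      by simp
    ultimately show "\<eta>\<^sup>2 * \<gamma> / 8 * n < pair_count Z1 1 (?Q X) a b"
      by linarith
    have "\<eta>\<^sup>2 / 2 * card Z2 < pair_count Z2 D (?Q X) a b"
      using X(2) ab by (force simp: B2_def not_le)
    moreover have "\<eta>\<^sup>2 / 2 * (\<kappa> * n / 2) \<le> \<eta>\<^sup>2 / 2 * card Z2"
      using D by (intro mult_left_mono) (auto simp: cardZ2)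
    moreover have "\<eta>\<^sup>2 * \<kappa> / 4 * n = \<eta>\<^sup>2 / 2 * (\<kappa> * n / 2)"
      by simp
    ultimately show "\<eta>\<^sup>2 * \<kappa> / 4 * n < pair_count Z2 D (?Q X) a b"
      by linarith
  qed (use D \<kappa> \<kappa>' \<epsilon> in auto)
  define q where "q = exp (- min (2 * \<epsilon>\<^sup>2) (\<eta> ^ 4 * \<kappa> / 4) * n)"
  have q: "exp (- c * n) \<le> q" if "min (2 * \<epsilon>\<^sup>2) (\<eta> ^ 4 * \<kappa> / 4) \<le> c" for c
    using that by (simp add: q_def mult_right_mono)
  have pA1: "measure_pmf.prob ?M (A1 j) \<le> 2 * q" if "j \<in> ?J" for j
    using card_prob[OF that \<epsilon>(1)] q[of "2 * \<epsilon>\<^sup>2"] by (simp add: A1_def)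
  have pA2: "measure_pmf.prob ?M (A2 j) \<le> 2 * q" if "j \<in> ?J" for j
    using sum_prob[OF that \<epsilon>(1)] q[of "2 * \<epsilon>\<^sup>2"] by (simp add: A2_def)
  have size: "exp (- (\<eta> ^ 4 / 2) * m) \<le> q" if "\<kappa> * n / 2 \<le> m" for m :: real
  proof -
    have "\<eta> ^ 4 * \<kappa> / 4 * n \<le> \<eta> ^ 4 / 2 * m"
      using mult_left_mono[OF that, of "\<eta> ^ 4 / 2"] by simp
    then have "exp (- (\<eta> ^ 4 / 2) * m) \<le> exp (- (\<eta> ^ 4 * \<kappa> / 4) * n)"
      by simp
    also have "\<dots> \<le> q"
      by (rule q) simp
    finally show ?thesis .
  qed
  have "\<kappa> * n / 2 \<le> card Z1"
    using cardZ1 MD n_large M by linarith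
  then have pB1: "measure_pmf.prob ?M (B1 p) \<le> q" if pJ: "p \<in> ?J \<times> ?J" for p
  proof -
    obtain a b where p: "p = (a, b)" "a \<in> ?J" "b \<in> ?J"
      using pJ by auto
    show ?thesis
      using pair_prob[OF p(2,3) Z1_pairs(1,2,4,3) order_refl Mn] size[OF \<open>\<kappa> * n / 2 \<le> card Z1\<close>]
      unfolding p(1) B1_def prod.case by linarith
  qed
  have pB2: "measure_pmf.prob ?M (B2 p) \<le> q" if pJ: "p \<in> ?J \<times> ?J" for p
  proof -
    obtain a b where p: "p = (a, b)" "a \<in> ?J" "b \<in> ?J"
      using pJ by auto
    show ?thesis
      using pair_prob[OF p(2,3) Z2_pairs(1,2,4,3) D(3) Mn] size[OF D(2)]
      unfolding p(1) B2_def prod.case cardZ2 by linarith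
  qed
  have UN: "measure_pmf.prob ?M (\<Union>i\<in>I. A i) \<le> card I * r"
    if "finite I" "\<And>i. i \<in> I \<Longrightarrow> measure_pmf.prob ?M (A i) \<le> r" for I :: "'x set" and A and r :: real
  proof -
    have "measure_pmf.prob ?M (\<Union>i\<in>I. A i) \<le> (\<Sum>i\<in>I. measure_pmf.prob ?M (A i))"
      using that by (intro measure_pmf.finite_measure_subadditive_finite) auto
    also have "\<dots> \<le> card I * r"
      using that by (intro sum_bounded_above) auto
    finally show ?thesis .
  qed
  let ?U1 = "\<Union>j\<in>?J. A1 j" and ?U2 = "\<Union>j\<in>?J. A2 j" and ?U3 = "\<Union>p\<in>?J \<times> ?J. B1 p" and ?U4 = "\<Union>p\<in>?J \<times> ?J. B2 p"
  \<comment> \<open>The inclusion holds only almost surely, because the rounded sets are known to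
    form a partition only on the support.\<close>
  have "AE X in ?M. X \<in> {X. can_fail n k P (Moving (?Q X))} \<longrightarrow> X \<in> ?U1 \<union> ?U2 \<union> ?U3 \<union> ?U4"
    by (rule AE_pmfI) (use good in blast)
  then have "measure_pmf.prob ?M {X. can_fail n k P (Moving (?Q X))} \<le> measure_pmf.prob ?M (?U1 \<union> ?U2 \<union> ?U3 \<union> ?U4)"
    by (rule measure_pmf.finite_measure_mono_AE) simp
  also have "\<dots> \<le> measure_pmf.prob ?M ?U1 + measure_pmf.prob ?M ?U2 + measure_pmf.prob ?M ?U3 + measure_pmf.prob ?M ?U4"
    by (intro order_trans[OF measure_Un_le] add_mono order_refl) auto
  \<comment> \<open>Two-sided bounds for k sizes and k sums cost 2q each; one-sided bounds for k^2
    ordered pairs and two differences cost q each.\<close>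
  also have "\<dots> \<le> card ?J * (2 * q) + card ?J * (2 * q) + card (?J \<times> ?J) * q + card (?J \<times> ?J) * q"
    by (intro add_mono UN pA1 pA2 pB1 pB2) auto
  also have "\<dots> = (4 * k + 2 * k\<^sup>2) * q"
    by (simp add: power2_eq_square algebra_simps)
  finally show ?thesis
    by (simp add: q_def)
qed

section \<open>Constants of the linear family\<close>

lemma exp_absorbs_factor:
  fixes c K :: real
  assumes "0 < c" "0 \<le> K"
  obtains N :: nat where "\<And>n. N \<le> n \<Longrightarrow> K * exp (- c * n) \<le> exp (- (c / 2) * n)"
proof
  \<comment> \<open>Taking \<open>K + 1\<close> keeps the logarithm meaningful for
    \<open>K = 0\<close>. Half of the exponent is given up to absorb the factor.\<close>
  fix n :: nat assume "nat \<lceil>2 * ln (K + 1) / c\<rceil> \<le> n"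
  then have "2 * ln (K + 1) / c \<le> n"
    by linarith
  then have "ln (K + 1) \<le> c / 2 * n"
    using assms by (simp add: field_simps)
  then have "exp (ln (K + 1)) \<le> exp (c / 2 * n)"
    by simp
  then have "K \<le> exp (c / 2 * n)"
    using assms by simp
  then have "K * exp (- c * n) \<le> exp (c / 2 * n) * exp (- c * n)"
    by (intro mult_right_mono) auto
  also have "\<dots> = exp (- (c / 2) * n)"
    unfolding exp_add[symmetric] by (simp add: field_simps)
  finally show "K * exp (- c * n) \<le> exp (- (c / 2) * n)" .
qed

lemma sum_top_elements:
  assumes "V \<le> n"
  shows "(\<Sum>l<V. real (n - l)) = V * n - V * (real V - 1) / 2"
  using assms by (induction V) (auto simp: of_nat_diff field_simps)

theorem theorem1p11:
  fixes \<alpha> :: "real list"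
  assumes "set \<alpha> \<subseteq> \<rat>"
    and "\<forall>a\<in>set \<alpha>. a > 0"
    and "sorted \<alpha>"
    and "sum_list \<alpha> = 1"
    and "slack \<alpha> > 0"
  shows "\<exists>\<delta>::real. \<delta> > 0 \<and> (\<exists>N::nat. \<forall>n\<ge>N. \<forall>k P.
           (n, k, P) \<in> linear_partition_family \<alpha> \<longrightarrow>
           rr_failure_prob (n, k, P) \<le> exp (- \<delta> * real n))"
proof -
  define k where "k = length \<alpha>"
  have k_pos: "1 \<le> k"
    using assms(4) by (cases \<alpha>) (auto simp: k_def)
  have pos: "0 < \<alpha> ! j" if "j < k" for j
    using assms(2) that by (simp add: k_def)
  have mono: "\<alpha> ! j \<le> \<alpha> ! j'" if "j \<le> j'" "j' < k" for j j'
    using assms(3) that by (simp add: k_def sorted_nth_mono)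
  have sum_take: "sum_list (take m \<alpha>) = (\<Sum>j<m. \<alpha> ! j)" if "m \<le> k" for m
    using that by (simp add: sum_list_sum_nth k_def min_absorb2 atLeast0LessThan)
  have sum1: "(\<Sum>j<k. \<alpha> ! j) = 1"
    using sum_take[of k] assms(4) by (simp add: k_def)
  have le1: "\<alpha> ! j \<le> 1" if "j < k" for j
    unfolding sum1[symmetric] using that pos by (intro member_le_sum) (auto intro: less_imp_le)
  \<comment> \<open>The inserted 1 keeps the set nonempty, hence \<sigma> positive, when
    \<open>k = 1\<close>.\<close>
  define \<sigma> where "\<sigma> = Min (insert 1 (slack_at \<alpha> ` {1..<k}))"
  have slack_pos: "0 < slack_at \<alpha> j" if "j \<in> {1..<k}" for j
  proof -
    have "slack \<alpha> \<le> ereal (slack_at \<alpha> j)"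
      unfolding slack_def using that by (intro INF_lower) (simp add: k_def)
    with assms(5) have "0 < ereal (slack_at \<alpha> j)"
      by (rule less_le_trans)
    then show ?thesis by simp
  qed
  have \<sigma>_pos: "0 < \<sigma>"
    unfolding \<sigma>_def using slack_pos by (subst Min_gr_iff) auto
  have \<sigma>_le: "\<sigma> \<le> slack_at \<alpha> j" if "j \<in> {1..<k}" for j
    unfolding \<sigma>_def using that by (intro Min_le) auto
  \<comment> \<open>The smallest share \<open>\<alpha> ! 0\<close> makes all targets large enough.
    Only half of \<sigma> is used, since the exact sums differ from their quadratic leading
    terms.\<close>
  define c where "c = min (\<sigma> / 2) (\<alpha> ! 0)"
  define \<gamma> where "\<gamma> = \<alpha> ! (k - 1)"
  define \<eta> where "\<eta> = c ^ (k - 1)"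
  define \<kappa> where "\<kappa> = \<eta>\<^sup>2 * \<gamma> / (32 * k)"
  define \<epsilon> where "\<epsilon> = \<eta>\<^sup>2 * \<kappa>\<^sup>2 / (32 * k)"
  define r where "r = min (2 * \<epsilon>\<^sup>2) (\<eta> ^ 4 * \<kappa> / 4)"
  have c: "0 < c" "c \<le> 1" "c \<le> \<sigma> / 2" "c \<le> \<alpha> ! 0"
    using \<sigma>_pos pos[of 0] le1[of 0] k_pos by (auto simp: c_def)
  have \<gamma>: "0 < \<gamma>" "\<gamma> \<le> 1"
    using pos[of "k - 1"] le1[of "k - 1"] k_pos by (auto simp: \<gamma>_def)
  have \<eta>01: "0 < \<eta>" "\<eta> \<le> 1"
    using c by (auto simp: \<eta>_def power_le_one)
  have \<kappa>: "0 < \<kappa>"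
    using \<eta>01 \<gamma> k_pos by (simp add: \<kappa>_def)
  have "0 < \<epsilon>"
    using \<eta>01 \<kappa> k_pos by (simp add: \<epsilon>_def)
  then have r: "0 < r"
    using \<eta>01 \<kappa> by (simp add: r_def)
  obtain N :: nat where N: "\<And>n. N \<le> n \<Longrightarrow> (4 * k + 2 * k\<^sup>2) * exp (- r * real n) \<le> exp (- (r / 2) * real n)"
    using exp_absorbs_factor[OF r, of "4 * k + 2 * k\<^sup>2"] by auto
  have main: "rr_failure_prob (n, k', P) \<le> exp (- (r / 2) * n)"
    if n: "N \<le> n" "1 / \<kappa> \<le> n" "1 / \<sigma> \<le> n" and fam: "(n, k', P) \<in> linear_partition_family \<alpha>" for n k' P
  proof -
    have k': "k' = k" and n_pos: "0 < n" and P: "map real P = map (\<lambda>a. a * real n) \<alpha>"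
      and int: "target_sum n k \<in> \<int>"
      using fam by (auto simp: linear_partition_family_def k_def)
    have len: "length P = k"
      using P by (metis k_def length_map)
    have Pj: "real (P ! j) = \<alpha> ! j * n" if "j < k" for j
      using arg_cong[OF P, of "\<lambda>xs. xs ! j"] that len by (simp add: k_def)
    have Pm: "real (\<Sum>j<m. P ! j) = (\<Sum>j<m. \<alpha> ! j) * n" if "m \<le> k" for m
      using that Pj by (simp add: sum_distrib_right)
    have "real (\<Sum>j<k. P ! j) = n"
      using Pm[of k] sum1 by simp
    then have P_sum: "(\<Sum>j<k. P ! j) = n"
      by (simp only: of_nat_eq_iff)
    have prefix: "m * target_sum n k + c * n ^ 2 \<le> (\<Sum>l<(\<Sum>j<m. P ! j). real (n - l))"
      if m: "1 \<le> m" "m < k" for m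
    proof -
      define A where "A = (\<Sum>j<m. \<alpha> ! j)"
      have A0: "0 \<le> A"
        unfolding A_def using pos m by (intro sum_nonneg) (auto intro: less_imp_le)
      have V: "real (\<Sum>j<m. P ! j) = A * n"
        using Pm[of m] m by (simp only: A_def less_imp_le)
      have "(\<Sum>j<m. P ! j) \<le> (\<Sum>j<k. P ! j)"
        using m by (intro sum_mono2) auto
      then have top: "(\<Sum>l<(\<Sum>j<m. P ! j). real (n - l)) = A * n * n - A * n * (A * n - 1) / 2"
        unfolding P_sum by (subst sum_top_elements) (simp_all only: V)
      have "slack_at \<alpha> m = A * (1 - A / 2) - m / (2 * k)"
        using sum_take[of m] m by (simp add: slack_at_def Let_def k_def A_def)
      then have "\<sigma> \<le> A * (1 - A / 2) - m / (2 * k)"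
        using \<sigma>_le[of m] m by simp
      then have 1: "(\<sigma> + m / (2 * k)) * n\<^sup>2 \<le> A * (1 - A / 2) * n\<^sup>2"
        by (intro mult_right_mono) auto
      have 2: "c * n\<^sup>2 \<le> \<sigma> / 2 * n\<^sup>2"
        using c by (intro mult_right_mono) auto
      \<comment> \<open>The other half of \<sigma> pays for the linear term
        \<open>m / (2 * k) * n\<close> of \<open>m * target_sum n k\<close>, which is at most n / 2;
        this is where n has to exceed 1 / \<sigma>.\<close>
      have "1 \<le> \<sigma> * n"
        using n(3) \<sigma>_pos by (simp add: field_simps)
      then have 3: "1 / 2 * n \<le> \<sigma> * n / 2 * n"
        by (intro mult_right_mono) auto
      have "m / (2 * k) \<le> 1 / 2"
        using m by (simp add: field_simps)
      then have 4: "m / (2 * k) * n \<le> 1 / 2 * n"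
        by (intro mult_right_mono) auto
      have 5: "m * target_sum n k = m / (2 * k) * n\<^sup>2 + m / (2 * k) * n"
        by (simp add: target_sum_def power2_eq_square algebra_simps add_divide_distrib)
      have "A * n * n - A * n * (A * n - 1) / 2 = A * (1 - A / 2) * n\<^sup>2 + A * n / 2"
        by (simp add: power2_eq_square algebra_simps diff_divide_distrib)
      moreover have "0 \<le> A * n / 2"
        using A0 by simp
      moreover have "(\<sigma> + m / (2 * k)) * n\<^sup>2 = \<sigma> / 2 * n\<^sup>2 + \<sigma> * n / 2 * n + m / (2 * k) * n\<^sup>2"
        by (simp add: power2_eq_square algebra_simps)
      ultimately show ?thesis
        unfolding top 5 using 1 2 3 4 by linarith
    qed
    interpret mixing n k "\<lambda>j. P ! j" "target_sum n k" c
    proof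
      show "P ! j \<le> P ! j'" if "j \<le> j'" "j' < k" for j j'
      proof -
        have "real (P ! j) \<le> real (P ! j')"
          using that mono[OF that] by (simp add: Pj mult_right_mono)
        then show ?thesis by simp
      qed
      show "c * n \<le> real (P ! j)" if "j < k" for j
        using that c mono[of 0 j] by (simp add: Pj mult_right_mono)
      show "k * target_sum n k = n * (n + 1) / 2"
        using k_pos by (simp add: target_sum_def, simp add: distrib_left)
    qed (use k_pos P_sum n_pos c prefix in auto)
    obtain x where x: "fluid_mixing (instance_sources n) (instance_targets n k P) = Some x"
      "fractional_solution (instance_sources n) (instance_targets n k P) x"
      "\<And>l j. n - P ! (k - 1) \<le> l \<Longrightarrow> l < n \<Longrightarrow> j < k \<Longrightarrow> c ^ (k - 1) \<le> x ! l ! j"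
      using fluid_mixing_instance[of P] by auto
    interpret rounding n k P x "P ! (k - 1)" \<eta>
      by unfold_locales (use x n_pos \<eta>01 in \<open>auto simp: \<eta>_def\<close>)
    obtain t where t: "target_sum n k = real t"
    proof -
      obtain z where z: "target_sum n k = of_int z"
        using int by (auto elim: Ints_cases)
      moreover have "0 \<le> target_sum n k"
        by (simp add: target_sum_def)
      ultimately show thesis
        using that[of "nat z"] by simp
    qed
    have "(\<Sum>j\<in>{1..k}. P ! (j - 1)) = n"
      unfolding P_sum[symmetric] by (rule sum.reindex_bij_witness[of _ Suc "\<lambda>j. j - 1"]) auto
    moreover have "real (P ! (k - 1)) = \<gamma> * n"
      using Pj[of "k - 1"] k_pos by (simp add: \<gamma>_def)
    moreover have "1 \<le> \<kappa> * n"
      using n(2) \<kappa> by (simp add: field_simps)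
    ultimately have "measure_pmf.prob (rounding_pmf n k x) {X. can_fail n k P (Moving (rounded_sets n X))}
        \<le> (4 * k + 2 * k\<^sup>2) * exp (- r * n)"
      using failure_prob_le[OF t k_pos _ _ \<gamma> \<eta>01(2), folded \<kappa>_def, folded \<epsilon>_def, folded r_def] by blast
    also have "\<dots> \<le> exp (- (r / 2) * n)"
      using N n(1) by simp
    finally show ?thesis
      using x(1,2) by (simp add: rr_failure_prob_def k')
  qed
  have "\<forall>n\<ge>max N (max (nat \<lceil>1 / \<kappa>\<rceil>) (nat \<lceil>1 / \<sigma>\<rceil>)). \<forall>k P. (n, k, P) \<in> linear_partition_family \<alpha> \<longrightarrow>
      rr_failure_prob (n, k, P) \<le> exp (- (r / 2) * n)"
  proof (intro allI impI)
    fix n k P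
    assume n: "max N (max (nat \<lceil>1 / \<kappa>\<rceil>) (nat \<lceil>1 / \<sigma>\<rceil>)) \<le> n" and fam: "(n, k, P) \<in> linear_partition_family \<alpha>"
    have "N \<le> n" "1 / \<kappa> \<le> n" "1 / \<sigma> \<le> n"
      using n by linarith+
    then show "rr_failure_prob (n, k, P) \<le> exp (- (r / 2) * n)"
      using fam by (rule main)
  qed
  moreover have "0 < r / 2"
    using r by simp
  ultimately show ?thesis
    by blast
qed

end
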